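(* Let $\alpha\in(0,1)$ and $\theta>0$ be fixed. Consider a pair of linear functionals $$\mathfrak{L}_1:=\int_{\mathbb{R}}\varphi\,\mathrm{d}\widetilde{\mathfrak{p}}\qquad\text{and}\qquad \mathfrak{L}_2:=\int_{\mathbb{R}}\psi\,\mathrm{d}\widetilde{\mathfrak{p}},$$ where $\widetilde{\mathfrak{p}}$ is a Pitman--Yor process with parameters $(\alpha,\theta)$ and base probability measure $\mathsf{G}$, and $\varphi,\psi:\mathbb{R}\to\mathbb{R}$ are two measurable functions satisfying $\|\varphi\|_\infty\le1$ and $\|\psi\|_\infty\le1$. Then, for any fixed probability measure $\mathsf{G}$ on $(\mathbb{R},\mathscr{B}(\mathbb{R}))$, the joint moments of $(\mathfrak{L}_1,\mathfrak{L}_2)$ (with $n,m$ non-negative integers) are given by $$\mathbb{E}_{(\alpha,\theta)}[\mathfrak{L}_1^n\mathfrak{L}_2^m]=\frac{m!}{(n+m)!}\,\frac{1}{(\theta)_{n+m}}\,\frac{\partial^{n+m}}{\partial z^{n}\,\partial w^{m}}\left[\left(\int_{\mathbb{R}}\{1-z[\varphi(x)+w\psi(x)]\}^{\alpha}\,\mathsf{G}(\mathrm{d}x)\right)^{-\theta/\alpha}\right]_{z=w=0}$$ $$=\frac{1}{(\theta)_{n+m}}\,\frac{\partial^{n+m}}{\partial u^n\,\partial v^m}\left[\left(\int_{\mathbb{R}}[1-u\varphi(x)-v\psi(x)]^{\alpha}\,\mathsf{G}(\mathrm{d}x)\right)^{-\theta/\alpha}\right]_{u=v=0}.$$ Consequently,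 the second of these expressions yields the joint Stieltjes transform $$\mathbb{E}_{(\alpha,\theta)}\left[\left(\frac{1}{1+s\mathfrak{L}_1+t\mathfrak{L}_2}\right)^{\theta}\right]=\left\{\int_{\mathbb{R}}[1+s\varphi(x)+t\psi(x)]^{\alpha}\,\mathsf{G}(\mathrm{d}x)\right\}^{-\theta/\alpha}\qquad(\ast)$$ valid for all $|s|<1/2$ and $|t|<1/2$. Furthermore, if $\varphi$ and $\psi$ are non-negative and satisfy the integrability condition $\int_{\mathbb{R}}[\varphi(x)^{\alpha}+\psi(x)^{\alpha}]\,\mathsf{G}(\mathrm{d}x)<+\infty$, the validity of $(\ast)$ extends to any $s,t>0$.
   Context: Pitman--Yor process with parameters $\alpha\in[0,1)$, $\theta>-\alpha$ and base probability measure $\mathsf{G}$ on $\mathbb{R}$: let $V_n\sim\mathrm{Beta}(1-\alpha,\theta+n\alpha)$, $n\ge1$, be independent, put $\omega_1:=V_1$ and $\omega_n:=V_n\prod_{i=1}^{n-1}(1-V_i)$ for $n\ge2$, and let $\xi_1,\xi_2,\dots$ be i.i.d. with law $\mathsf{G}$, independent of $(V_n)_{n\ge1}$. Then $\widetilde{\mathfrak{p}}:=\sum_{n\ge1}\omega_n\delta_{\xi_n}$, where $\delta_x$ is the Dirac probability measure at $x$. $\mathscr{B}(\mathbb{R})$ is the Borel $\sigma$-algebra of $\mathbb{R}$, and $\mathbb{E}_{(\alpha,\theta)}$ denotes expectation with respect to the randomness of $\widetilde{\mathfrak{p}}$. The rising factorial is $(\theta)_k:=\theta(\theta+1)\cdots(\theta+k-1)$,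 with $(\theta)_0:=1$.
   Formalization: The first moment formula fails as printed (ψ≡1, n=0, m=1 gives 1=0); it is proved with m! replaced by n! and the derivative replaced by ∂^{n+2m}/∂z^{n+m}∂w^m, the rest being as stated. *)

theory Defs
  imports "HOL-Probability.Probability"
begin

definition beta_density :: "real \<Rightarrow> real \<Rightarrow> real \<Rightarrow> real" where
  "beta_density a b x =
     (if 0 < x \<and> x < 1 then x powr (a - 1) * (1 - x) powr (b - 1) / Beta a b else 0)"

text \<open>Sequences are indexed from 0 here, whereas the sticks and atoms are customarily
  numbered from 1; the index \<open>n\<close> below stands for the customary \<open>n + 1\<close>.\<close>

definition stick_weight :: "(nat \<Rightarrow> real) \<Rightarrow> nat \<Rightarrow> real" where
  "stick_weight v n = v n * (\<Prod>i<n. 1 - v i)"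

definition weighted_diracs :: "(nat \<Rightarrow> real) \<Rightarrow> (nat \<Rightarrow> real) \<Rightarrow> real measure" where
  "weighted_diracs w x =
     measure_of UNIV (sets borel) (\<lambda>A. \<Sum>n. ennreal (w n) * emeasure (return borel (x n)) A)"

lemma space_weighted_diracs [simp]: "space (weighted_diracs w x) = UNIV"
  and sets_weighted_diracs [simp, measurable_cong]: "sets (weighted_diracs w x) = sets borel"
  unfolding weighted_diracs_def
  using sets.sigma_sets_eq[of "borel :: real measure"]
  by (simp_all add: space_measure_of sets_measure_of)

text \<open>\<open>measure_of\<close> yields the null measure when its argument is not a measure;
  the following lemma shows that this does not happen here.\<close>

lemma emeasure_weighted_diracs:
  assumes "A \<in> sets borel"
  shows "emeasure (weighted_diracs w x) A
           = (\<Sum>n. ennreal (w n) * emeasure (return borel (x n)) A)"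
  unfolding weighted_diracs_def
proof (rule emeasure_measure_of_sigma)
  let ?\<mu> = "\<lambda>A. \<Sum>n. ennreal (w n) * emeasure (return borel (x n)) A"
  show "sigma_algebra UNIV (sets (borel :: real measure))"
    using sets.sigma_algebra_axioms[of "borel :: real measure"] by simp
  show "positive (sets borel) ?\<mu>"
    by (simp add: positive_def)
  show "countably_additive (sets borel) ?\<mu>"
    unfolding countably_additive_def
  proof (intro allI impI)
    fix B :: "nat \<Rightarrow> real set"
    assume B: "range B \<subseteq> sets borel" "disjoint_family B" "(\<Union>i. B i) \<in> sets borel"
    have "(\<Sum>i. ?\<mu> (B i)) = (\<Sum>n. \<Sum>i. ennreal (w n) * emeasure (return borel (x n)) (B i))"
      unfolding nn_integral_count_space_nat[symmetric]
      by (rule pair_sigma_finite.Fubini'[symmetric])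
        (auto simp: pair_sigma_finite_def pair_measure_countable
              intro: sigma_finite_measure_count_space)
    also have "\<dots> = ?\<mu> (\<Union>i. B i)"
      using B by (auto simp: image_subset_iff suminf_indicator)
    finally show "(\<Sum>i. ?\<mu> (B i)) = ?\<mu> (\<Union>i. B i)" .
  qed
qed (fact assms)

definition pitman_yor_process ::
  "'a measure \<Rightarrow> real \<Rightarrow> real \<Rightarrow> real measure \<Rightarrow> ('a \<Rightarrow> real measure) \<Rightarrow> bool" where
  "pitman_yor_process M \<alpha> \<theta> G p \<longleftrightarrow>
     prob_space M \<and> prob_space G \<and> sets G = sets borel \<and> 0 \<le> \<alpha> \<and> \<alpha> < 1 \<and> - \<alpha> < \<theta> \<and>
     (\<exists>(V :: nat \<Rightarrow> 'a \<Rightarrow> real) (\<xi> :: nat \<Rightarrow> 'a \<Rightarrow> real).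
        prob_space.indep_vars M (\<lambda>_. borel) V UNIV \<and>
        (\<forall>n. distributed M lborel (V n) (beta_density (1 - \<alpha>) (\<theta> + real (n + 1) * \<alpha>))) \<and>
        prob_space.indep_vars M (\<lambda>_. borel) \<xi> UNIV \<and>
        (\<forall>n. distr M borel (\<xi> n) = G) \<and>
        prob_space.indep_var M
          (\<Pi>\<^sub>M n\<in>UNIV. borel) (\<lambda>\<omega> n. V n \<omega>) (\<Pi>\<^sub>M n\<in>UNIV. borel) (\<lambda>\<omega> n. \<xi> n \<omega>) \<and>
        (\<forall>\<omega>\<in>space M. p \<omega> = weighted_diracs (stick_weight (\<lambda>n. V n \<omega>)) (\<lambda>n. \<xi> n \<omega>)))"

text \<open>\<open>mixed_partial j k F x y\<close> is \<open>\<partial>\<^sup>j\<^sup>+\<^sup>k F / \<partial>u\<^sup>j \<partial>v\<^sup>k\<close> at \<open>(u, v) = (x, y)\<close>, the derivatives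
  in the second argument being taken first.\<close>

definition mixed_partial :: "nat \<Rightarrow> nat \<Rightarrow> (real \<Rightarrow> real \<Rightarrow> real) \<Rightarrow> real \<Rightarrow> real \<Rightarrow> real" where
  "mixed_partial j k F x y = (deriv ^^ j) (\<lambda>u. (deriv ^^ k) (\<lambda>v. F u v) y) x"

end

theory Submission
  imports Defs
begin

text \<open>Write \<open>X\<^sub>N\<close> for the functional of a bounded \<open>f\<close> built from the sticks and atoms with index at
  least \<open>N\<close>, so that \<open>X\<^sub>N = V\<^sub>N f(\<xi>\<^sub>N) + (1 - V\<^sub>N) X\<^sub>N\<^sub>+\<^sub>1\<close>. With \<open>t = \<theta> + N \<alpha>\<close>, the beta moments turn this into
  a recursion for \<open>a\<^sub>N(k) = (t)\<^sub>k E[X\<^sub>N\<^sup>k] / k!\<close>, namely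
  \<open>a\<^sub>N(k) (1 + k / t) = \<Sum>\<^sub>j A\<^sub>j a\<^sub>N\<^sub>+\<^sub>1(k - j)\<close> with \<open>\<Sum>\<^sub>j A\<^sub>j u\<^sup>j = \<integral> (1 - u f)\<^sup>\<alpha>\<^sup>-\<^sup>1 dG\<close>. The coefficients of
  \<open>(\<integral> (1 - u f)\<^sup>\<alpha> dG)\<^sup>-\<^sup>t\<^sup>/\<^sup>\<alpha>\<close> satisfy the same recursion. If two solutions agree below \<open>k\<close>, their
  difference at \<open>k\<close> is multiplied by \<open>1 + k / t\<close> when \<open>N\<close> increases by one and hence grows like
  \<open>N\<^sup>k\<^sup>/\<^sup>\<alpha>\<close>, whereas both solutions are \<open>O(N\<^sup>k)\<close>; since \<open>\<alpha> < 1\<close>, the difference vanishes.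
  Summation gives \<open>E[(\<integral> g dp)\<^sup>-\<^sup>\<theta>] = (\<integral> g\<^sup>\<alpha> dG)\<^sup>-\<^sup>\<theta>\<^sup>/\<^sup>\<alpha>\<close> for \<open>g\<close> bounded and bounded away from \<open>0\<close>; the case
  \<open>f = 1\<close>, \<open>k = 1\<close> also shows that the weights sum to \<open>1\<close> almost surely. Expansion in powers of
  \<open>u\<close> and \<open>v\<close> yields the mixed moments. Unbounded non-negative integrands \<open>1 + c h\<close> are reached by
  truncation, and \<open>c \<rightarrow> 0\<close> shows that \<open>\<integral> h dp\<close> is finite almost surely.\<close>

subsection \<open>Power series and growth\<close>

lemma fps_nth_conv_higher_deriv:
  fixes f :: "'a :: {banach, real_normed_field} fps"
  assumes "fps_conv_radius f > 0"
  shows "(deriv ^^ n) (eval_fps f) 0 = fact n * fps_nth f n"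
  using assms
proof (induction n arbitrary: f)
  case 0
  then show ?case by (simp add: eval_fps_def)
next
  case (Suc n f)
  have ev: "\<forall>\<^sub>F z in nhds 0. deriv (eval_fps f) z = eval_fps (fps_deriv f) z"
    using Suc.prems by (intro eventually_nhds_in_open[of "eball 0 (fps_conv_radius f)", THEN eventually_mono])
      (auto simp: zero_ereal_def eval_fps_deriv)
  have "(deriv ^^ Suc n) (eval_fps f) 0 = (deriv ^^ n) (deriv (eval_fps f)) 0"
    unfolding funpow_Suc_right o_def ..
  also have "\<dots> = (deriv ^^ n) (eval_fps (fps_deriv f)) 0"
    using ev by (intro higher_deriv_cong_ev refl)
  also have "\<dots> = fact n * fps_nth (fps_deriv f) n"
    using Suc.prems fps_conv_radius_deriv[of f] by (intro Suc.IH) auto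
  finally show ?case by (simp add: algebra_simps)
qed

lemma fps_conv_radius_geI:
  fixes c :: "nat \<Rightarrow> real"
  assumes "r > 0" "\<And>x. \<bar>x\<bar> < r \<Longrightarrow> summable (\<lambda>k. c k * x ^ k)"
  shows "ereal r \<le> fps_conv_radius (Abs_fps c)"
  unfolding fps_conv_radius_def
proof (rule conv_radius_geI_ex)
  fix s assume "0 < s" "ereal s < ereal r"
  then show "\<exists>z. norm z = s \<and> summable (\<lambda>n. fps_nth (Abs_fps c) n * z ^ n)"
    using assms(2)[of s] by (intro exI[of _ s]) auto
qed

text \<open>Bridge from series to \<open>mixed_partial\<close>: derivatives at the origin are read
  off convergent expansions, so no differentiation under an integral sign is needed.\<close>

lemma higher_deriv_power_series_0:
  fixes c :: "nat \<Rightarrow> real"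
  assumes "r > 0" "\<And>x. \<bar>x\<bar> < r \<Longrightarrow> (\<lambda>k. c k * x ^ k) sums f x"
  shows "(deriv ^^ n) f 0 = fact n * c n"
proof -
  have R: "ereal r \<le> fps_conv_radius (Abs_fps c)"
    using assms by (intro fps_conv_radius_geI) (auto simp: sums_iff)
  have "\<forall>\<^sub>F x in nhds 0. f x = eval_fps (Abs_fps c) x"
    using assms by (intro eventually_nhds_in_open[of "ball 0 r", THEN eventually_mono])
      (auto simp: eval_fps_def sums_iff)
  then have "(deriv ^^ n) f 0 = (deriv ^^ n) (eval_fps (Abs_fps c)) 0"
    by (intro higher_deriv_cong_ev refl)
  also have "\<dots> = fact n * c n"
    using less_le_trans[OF _ R, of 0] assms(1) by (subst fps_nth_conv_higher_deriv) (auto simp: zero_ereal_def)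
  finally show ?thesis .
qed

section \<open>Binomial series and their expectations\<close>

lemma summable_abs_pochhammer_power:
  assumes "\<bar>z::real\<bar> < 1"
  shows "summable (\<lambda>k. \<bar>pochhammer c k / fact k * z ^ k\<bar>)"
proof -
  obtain w where w: "\<bar>z\<bar> < w" "w < 1" using dense[OF assms] by auto
  have "summable (\<lambda>k. (-c gchoose k) * w ^ k)"
    using gen_binomial_real[of w "-c"] w by (auto simp: sums_iff)
  from powser_insidea[OF this, of z] have "summable (\<lambda>k. norm ((-c gchoose k) * z ^ k))" using w by auto
  then show ?thesis by (simp add: gbinomial_pochhammer abs_mult power_abs)
qed

lemma pochhammer_binomial_sums:
  assumes "\<bar>z::real\<bar> < 1"
  shows "(\<lambda>k. pochhammer c k / fact k * z ^ k) sums (1 - z) powr (- c)"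
proof -
  have "(- 1) ^ k * ((- 1) ^ k * x) = (x::real)" for x k
    by (simp add: power_mult_distrib[symmetric] flip: mult.assoc)
  then have "pochhammer c k / fact k * z ^ k = (-c gchoose k) * (- z) ^ k" for k
    unfolding gbinomial_pochhammer power_minus[of z] by (simp add: mult_ac)
  then show ?thesis using gen_binomial_real[of "-z" "-c"] assms by simp
qed

text \<open>Termwise integration, dominated by the absolute binomial series at \<bar>v\<bar> R < 1.
  The exponent c = -\<alpha> serves integrals over \<open>G\<close>, c = \<theta> or c = \<theta> +
  m those over the process. The weight \<open>X\<close> is 1 for a single expansion and nontrivial
  when two variables are expanded in turn.\<close>

lemma (in finite_measure) expectation_binomial_sums:
  fixes X Y :: "'a \<Rightarrow> real"
  assumes [measurable]: "X \<in> borel_measurable M" "Y \<in> borel_measurable M"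
    and X: "\<And>x. x \<in> space M \<Longrightarrow> \<bar>X x\<bar> \<le> B" and Y: "\<And>x. x \<in> space M \<Longrightarrow> \<bar>Y x\<bar> \<le> R"
    and vR: "\<bar>v\<bar> * R < 1"
  shows "(\<lambda>k. pochhammer c k / fact k * (LINT x|M. X x * Y x ^ k) * v ^ k)
           sums (LINT x|M. X x * (1 - v * Y x) powr (- c))"
proof (cases "space M = {}")
  case True
  then have "(LINT x|M. f x) = 0" for f :: "'a \<Rightarrow> real"
    by (simp add: Bochner_Integration.integral_empty)
  then show ?thesis by simp
next
  case False
  \<comment> \<open>A point is needed to know that \<open>B\<close> and \<open>R\<close> are
    nonnegative; this is why the empty space is treated apart.\<close>
  then obtain x0 where "x0 \<in> space M" by auto
  then have B: "0 \<le> B" "0 \<le> R" using X[of x0] Y[of x0] by auto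
  define f where "f k x = pochhammer c k / fact k * v ^ k * (X x * Y x ^ k)" for k x
  define b where "b k = B * \<bar>pochhammer c k / fact k * (\<bar>v\<bar> * R) ^ k\<bar>" for k
  have f_le: "\<bar>f k x\<bar> \<le> b k" if "x \<in> space M" for k x
  proof -
    have "\<bar>X x\<bar> * \<bar>Y x\<bar> ^ k \<le> B * R ^ k"
      using X[OF that] Y[OF that] B by (intro mult_mono power_mono) auto
    then have "\<bar>pochhammer c k / fact k * v ^ k\<bar> * (\<bar>X x\<bar> * \<bar>Y x\<bar> ^ k) \<le> \<bar>pochhammer c k / fact k * v ^ k\<bar> * (B * R ^ k)"
      by (rule mult_left_mono) simp
    then show ?thesis
      using B by (simp add: f_def b_def abs_mult power_abs power_mult_distrib mult_ac)
  qed
  have b: "summable b"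
    unfolding b_def using vR B by (intro summable_mult summable_abs_pochhammer_power) auto
  have int: "integrable M (f k)" for k
    using f_le[of _ k] by (intro integrable_const_bound[of _ "b k"] AE_I2) (simp_all add: f_def[abs_def])
  have "(\<lambda>k. LINT x|M. f k x) sums (LINT x|M. (\<Sum>k. f k x))"
  proof (rule sums_integral)
    show "AE x in M. summable (\<lambda>i. norm (f i x))"
      using f_le by (intro AE_I2 summable_comparison_test[OF _ b]) auto
    have "(LINT x|M. norm (f i x)) \<le> b i * measure M (space M)" for i
    proof -
      have "(LINT x|M. norm (f i x)) \<le> (LINT x|M. b i)"
        using int f_le by (intro integral_mono) auto
      then show ?thesis by (simp add: mult.commute)
    qed
    then show "summable (\<lambda>i. LINT x|M. norm (f i x))"
      by (intro summable_comparison_test[OF _ summable_mult2[OF b, of "measure M (space M)"]])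
        (auto intro!: exI[of _ 0])
  qed (fact int)
  also have "(LINT x|M. (\<Sum>k. f k x)) = (LINT x|M. X x * (1 - v * Y x) powr (- c))"
  proof (rule Bochner_Integration.integral_cong[OF refl])
    fix x assume x: "x \<in> space M"
    have "\<bar>v * Y x\<bar> \<le> \<bar>v\<bar> * R" unfolding abs_mult using Y[OF x] by (intro mult_left_mono) auto
    then have "(\<lambda>k. X x * (pochhammer c k / fact k * (v * Y x) ^ k)) sums (X x * (1 - v * Y x) powr (- c))"
      using vR by (intro sums_mult pochhammer_binomial_sums) auto
    then show "(\<Sum>k. f k x) = X x * (1 - v * Y x) powr (- c)"
      by (simp add: sums_iff f_def power_mult_distrib mult_ac)
  qed
  finally show ?thesis
    unfolding f_def integral_mult_right_zero by (simp only: mult_ac)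
qed

text \<open>The factor \<open>1 + e / (x + N)\<close> makes \<open>d\<close> grow like \<open>N\<^sup>e\<close>, faster than the bound of order \<open>N\<^sup>k\<close>;
  the ratio of the two is bounded below by partial sums of a harmonic series.\<close>

lemma zero_if_growth_exceeds_pochhammer:
  fixes d :: "nat \<Rightarrow> real"
  assumes x: "x > 0" and e: "e > real k"
    and step: "\<And>N. d (Suc N) = d N * (1 + e / (x + real N))"
    and bound: "\<And>N. \<bar>d N\<bar> \<le> C * pochhammer (x + real N) k"
  shows "d N = 0"
proof -
  define q where "q N = \<bar>d N\<bar> / pochhammer (x + real N) k" for N
  have pos: "pochhammer (x + real N) k > 0" for N using x by (intro pochhammer_pos) auto
  have q_le: "q N \<le> C" for N using bound[of N] pos[of N] by (simp add: q_def field_simps)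
  \<comment> \<open>From N to N + 1, \<open>d\<close> gains the factor (x + N + e) / (x + N) and the
    rising factorial the factor (x + N + k) / (x + N), so their ratio \<open>q\<close> gains (x + N
    + e) / (x + N + k) = 1 + b N.\<close>
  define b where "b N = (e - real k) / (x + real N + real k)" for N
  have b: "b N \<ge> 0" for N unfolding b_def using x e by auto
  have q_Suc: "q (Suc N) = q N * (1 + b N)" for N
  proof -
    have A: "(x + real N) * pochhammer (x + real (Suc N)) k = pochhammer (x + real N) k * (x + real N + real k)"
      using pochhammer_rec[of "x + real N" k] pochhammer_rec'[of "x + real N" k] by (simp add: algebra_simps)
    have p: "x + real N > 0" "x + real N + real k > 0" using x by auto
    have E: "pochhammer (x + real (Suc N)) k = pochhammer (x + real N) k * (x + real N + real k) / (x + real N)"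
      using A p by (simp add: field_simps)
    have D: "\<bar>d (Suc N)\<bar> = \<bar>d N\<bar> * ((x + real N + e) / (x + real N))"
    proof -
      have "1 + e / (x + real N) = (x + real N + e) / (x + real N)" using p by (simp add: field_simps)
      then show ?thesis using p e x by (simp add: step abs_mult)
    qed
    have "1 + b N = (x + real N + e) / (x + real N + real k)" using p by (simp add: b_def field_simps)
    then show ?thesis unfolding q_def E D using p pos[of N] by simp
  qed
  have q_nonneg: "q N \<ge> 0" for N unfolding q_def using pos[of N] by simp
  have q_ge: "q 0 * (1 + (\<Sum>i<N. b i)) \<le> q N" for N
  proof (induction N)
    case (Suc N)
    have "q 0 \<le> q N"
      using Suc.IH mult_nonneg_nonneg[OF q_nonneg[of 0] sum_nonneg[of "{..<N}" b]] b by (simp add: algebra_simps)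
    then have "q 0 * b N \<le> q N * b N" using b by (intro mult_right_mono) auto
    then show ?case using Suc by (simp add: q_Suc algebra_simps)
  qed simp
  have "q 0 = 0"
  proof (rule ccontr)
    assume "q 0 \<noteq> 0"
    then have q0: "q 0 > 0" using q_nonneg[of 0] by simp
    have "(\<Sum>i<N. b i) \<le> C / q 0" for N
    proof -
      have "q 0 * (1 + (\<Sum>i<N. b i)) \<le> C" using q_ge q_le by (rule order_trans)
      then show ?thesis using q0 by (simp add: field_simps)
    qed
    then have "summable b" using b by (intro summableI_nonneg_bounded[where x = "C / q 0"]) auto
    moreover obtain m :: nat where m: "x + real k \<le> real m" using real_arch_simple by blast
    ultimately have sm: "summable (\<lambda>n. inverse (e - real k) * b n)" by (intro summable_mult)
    \<comment> \<open>The choice of \<open>m\<close> gives x + n + k \<le> n + m, so a tail of the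
      harmonic series is dominated by a multiple of \<open>b\<close>.\<close>
    have "norm (inverse (real (n + Suc m))) \<le> inverse (e - real k) * b n" for n
      using m e x by (simp add: b_def divide_simps)
    then have "summable (\<lambda>n. inverse (real (n + Suc m)))"
      by (blast intro: summable_comparison_test[OF _ sm])
    then have "summable (\<lambda>n. inverse (real n))" by (subst (asm) summable_iff_shift)
    then show False using not_summable_harmonic[where 'a = real] by (simp add: inverse_eq_divide)
  qed
  then have "d 0 = 0" using pos[of 0] by (simp add: q_def)
  then show ?thesis by (induction N) (simp_all add: step)
qed

subsection \<open>Real powers of formal power series\<close>

text \<open>For \<mu> j = \<integral> f^j dG this is the expansion of \<integral> (1 - u f)^(-c) dG
  in powers of u.\<close>

definition moment_fps :: "real \<Rightarrow> (nat \<Rightarrow> real) \<Rightarrow> real fps" where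
  "moment_fps c \<mu> = Abs_fps (\<lambda>j. pochhammer c j / fact j * \<mu> j)"

lemma moment_fps_nth: "fps_nth (moment_fps c \<mu>) j = pochhammer c j / fact j * \<mu> j"
  by (simp add: moment_fps_def)

text \<open>The formal power F^b of a series with constant term 1, obtained by substituting F - 1
  into the binomial series (1 + X)^b.\<close>

definition fps_real_powr :: "real fps \<Rightarrow> real \<Rightarrow> real fps" where
  "fps_real_powr F b = fps_binomial b oo (F - 1)"

lemma fps_real_powr_nth_0 [simp]: "fps_nth (fps_real_powr F b) 0 = 1"
  by (simp add: fps_real_powr_def)

lemma fps_real_powr_mult_base:
  assumes "fps_nth F 0 = 1"
  shows "fps_real_powr F (b - 1) * F = fps_real_powr F b"
proof -
  have F0: "fps_nth (F - 1) 0 = 0" using assms by simp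
  have "fps_real_powr F b = (fps_binomial (b - 1) * (1 + fps_X)) oo (F - 1)"
    using fps_binomial_add_mult[of "b - 1" 1] by (simp add: fps_real_powr_def fps_binomial_1)
  also have "\<dots> = fps_real_powr F (b - 1) * ((1 + fps_X) oo (F - 1))"
    unfolding fps_real_powr_def by (rule fps_compose_mult_distrib[OF F0])
  also have "(1 + fps_X) oo (F - 1) = F"
    using F0 by (simp add: fps_compose_add_distrib)
  finally show ?thesis by simp
qed

lemma fps_deriv_fps_real_powr:
  assumes "fps_nth F 0 = 1"
  shows "fps_deriv (fps_real_powr F b) = fps_const b * fps_real_powr F (b - 1) * fps_deriv F"
proof -
  have F0: "fps_nth (F - 1) 0 = 0" using assms by simp
  have "fps_deriv (fps_binomial b) = fps_const b * fps_binomial (b - 1)"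
    using gbinomial_absorption[of _ b] by (auto simp: fps_eq_iff)
  then have "fps_deriv (fps_real_powr F b) = ((fps_const b * fps_binomial (b - 1)) oo (F - 1)) * fps_deriv (F - 1)"
    unfolding fps_real_powr_def by (simp add: fps_compose_deriv[OF F0])
  also have "\<dots> = fps_const b * fps_real_powr F (b - 1) * fps_deriv F"
    unfolding fps_real_powr_def by (simp add: fps_compose_mult_distrib[OF F0])
  finally show ?thesis .
qed

text \<open>The dependence on y sits only in the binomial coefficients of -y, of modulus (y)_i / i!.
  For 1 \<le> i \<le> k this is at most (y)_k, because the remaining factors y + i, y + i + 1, ...
  are at least 1; for i = 0 the coefficient of (F - 1)^0 at k > 0 vanishes.\<close>

lemma fps_real_powr_growth:
  assumes "k > 0" "y > 0"
  shows "\<bar>fps_nth (fps_real_powr F (- y)) k\<bar> \<le> (\<Sum>i=0..k. \<bar>fps_nth ((F - 1) ^ i) k\<bar>) * pochhammer y k"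
proof -
  have "\<bar>(- y gchoose i) * fps_nth ((F - 1) ^ i) k\<bar> \<le> \<bar>fps_nth ((F - 1) ^ i) k\<bar> * pochhammer y k"
    if "i \<in> {0..k}" for i
  proof (cases "i = 0")
    case True
    then show ?thesis using assms by simp
  next
    case False
    have "1 \<le> pochhammer (y + real i) (k - i)"
      unfolding pochhammer_prod using False assms by (intro prod_ge_1) auto
    then have "pochhammer y i * 1 \<le> pochhammer y i * pochhammer (y + real i) (k - i)"
      using assms by (intro mult_left_mono) (auto intro: less_imp_le pochhammer_pos)
    then have le: "pochhammer y i \<le> pochhammer y k"
      using pochhammer_product[of i k y] that by simp
    have "\<bar>- y gchoose i\<bar> = pochhammer y i / fact i"
      using assms by (simp add: gbinomial_pochhammer abs_mult pochhammer_pos less_imp_le)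
    also have "\<dots> \<le> pochhammer y i / 1"
      using assms by (intro divide_left_mono) (auto intro: less_imp_le pochhammer_pos fact_ge_1)
    also note le
    finally have "\<bar>- y gchoose i\<bar> \<le> pochhammer y k" by simp
    then show ?thesis unfolding abs_mult by (subst mult.commute) (intro mult_left_mono, auto)
  qed
  then show ?thesis
    unfolding fps_real_powr_def fps_compose_nth sum_distrib_right fps_binomial_nth
    by (intro order_trans[OF sum_abs] sum_mono) auto
qed

text \<open>Coefficient form of (1 - u f)^(\<alpha> - 1) = (1 - u f)^\<alpha> + u f (1 - u
  f)^(\<alpha> - 1), whose last term is -1/\<alpha> times u d/du applied to (1 - u
  f)^\<alpha>.\<close>

lemma moment_fps_shift:
  assumes "\<alpha> > 0"
  shows "moment_fps (1 - \<alpha>) \<mu> =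
    moment_fps (- \<alpha>) \<mu> - fps_const (1 / \<alpha>) * (fps_X * fps_deriv (moment_fps (- \<alpha>) \<mu>))"
proof (rule fps_ext)
  fix j
  have fps_X_deriv: "fps_nth (fps_X * fps_deriv F) j = real j * fps_nth F j" for F :: "real fps"
    by (cases j) simp_all
  have "- \<alpha> * pochhammer (1 - \<alpha>) j = pochhammer (- \<alpha>) j * (real j - \<alpha>)"
    using pochhammer_rec[of "-\<alpha>" j] pochhammer_rec'[of "-\<alpha>" j] by (simp add: algebra_simps)
  then have *: "pochhammer (1 - \<alpha>) j = pochhammer (- \<alpha>) j * (1 - real j / \<alpha>)"
    using assms by (simp add: field_simps)
  show "fps_nth (moment_fps (1 - \<alpha>) \<mu>) j = fps_nth (moment_fps (- \<alpha>) \<mu> -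
     fps_const (1 / \<alpha>) * (fps_X * fps_deriv (moment_fps (- \<alpha>) \<mu>))) j"
    using assms by (simp add: fps_X_deriv * moment_fps_nth field_simps)
qed

text \<open>Let D = u d/du and let I be the series of \<integral> (1 - u f)^\<alpha> dG. Multiplying
  the k-th coefficient by 1 + k / t is the operator 1 + D / t, and applied to I^(-t/\<alpha>) it
  gives I^(-t/\<alpha> - 1) (I - D I / \<alpha>), where the bracket is the series with exponent
  \<alpha> - 1 by \<open>moment_fps_shift\<close>.\<close>

lemma fps_real_powr_recursion:
  assumes "\<alpha> > 0" "t > 0" "\<mu> 0 = 1"
  defines "H \<equiv> fps_real_powr (moment_fps (- \<alpha>) \<mu>)"
  shows "fps_nth (H (- t / \<alpha>)) k * (1 + real k / t) =
    (\<Sum>j=0..k. fps_nth (moment_fps (1 - \<alpha>) \<mu>) j * fps_nth (H (- (t + \<alpha>) / \<alpha>)) (k - j))"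
proof -
  let ?I = "moment_fps (- \<alpha>) \<mu>"
  let ?b = "- t / \<alpha>"
  have I0: "fps_nth ?I 0 = 1" using assms by (simp add: moment_fps_nth)
  have b1: "- (t + \<alpha>) / \<alpha> = ?b - 1" using assms by (simp add: field_simps)
  have c: "fps_const (1 / t) * fps_const ?b = - fps_const (1 / \<alpha>)"
    using assms by (simp add: fps_const_neg[symmetric] del: fps_const_neg)
  have "H ?b + fps_const (1 / t) * (fps_X * fps_deriv (H ?b)) =
      H (?b - 1) * ?I + (fps_const (1 / t) * fps_const ?b) * (fps_X * (H (?b - 1) * fps_deriv ?I))"
    unfolding H_def fps_deriv_fps_real_powr[OF I0] fps_real_powr_mult_base[OF I0] by (simp add: mult_ac)
  also have "\<dots> = moment_fps (1 - \<alpha>) \<mu> * H (?b - 1)"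
    unfolding c moment_fps_shift[OF assms(1)] by (simp add: algebra_simps del: fps_const_neg)
  finally have "fps_nth (H ?b + fps_const (1 / t) * (fps_X * fps_deriv (H ?b))) k =
     fps_nth (moment_fps (1 - \<alpha>) \<mu> * H (?b - 1)) k" by simp
  moreover have "fps_nth (H ?b + fps_const (1 / t) * (fps_X * fps_deriv (H ?b))) k = fps_nth (H ?b) k * (1 + real k / t)"
    by (cases k) (simp_all add: field_simps)
  ultimately show ?thesis by (simp only: b1 fps_mult_nth[symmetric])
qed

text \<open>The recursion links N to N + 1 and comes with no starting value in N; the growth bound,
  uniform in N for each k, acts as the missing boundary condition at infinity.\<close>

lemma fps_real_powr_unique:
  assumes \<alpha>: "0 < \<alpha>" "\<alpha> < 1" and \<theta>: "\<theta> > 0" and \<mu>: "\<mu> 0 = 1"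
    and a0: "\<And>N. a N 0 = 1"
    and rec: "\<And>N k. a N k * (1 + real k / (\<theta> + real N * \<alpha>)) =
      (\<Sum>j=0..k. fps_nth (moment_fps (1 - \<alpha>) \<mu>) j * a (Suc N) (k - j))"
    and bound: "\<And>N k. \<bar>a N k\<bar> \<le> C k * pochhammer (\<theta> / \<alpha> + real N) k"
  shows "a N k = fps_nth (fps_real_powr (moment_fps (- \<alpha>) \<mu>) (- (\<theta> / \<alpha> + real N))) k"
proof -
  define H where "H N = fps_nth (fps_real_powr (moment_fps (- \<alpha>) \<mu>) (- (\<theta> / \<alpha> + real N)))" for N
  let ?A = "fps_nth (moment_fps (1 - \<alpha>) \<mu>)"
  have H_rec: "H N k * (1 + real k / (\<theta> + real N * \<alpha>)) = (\<Sum>j=0..k. ?A j * H (Suc N) (k - j))" for N k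
  proof -
    have "- (\<theta> + real N * \<alpha>) / \<alpha> = - (\<theta> / \<alpha> + real N)"
      "- (\<theta> + real N * \<alpha> + \<alpha>) / \<alpha> = - (\<theta> / \<alpha> + real (Suc N))"
      using \<alpha> by (simp_all add: field_simps)
    then show ?thesis
      using fps_real_powr_recursion[of \<alpha> "\<theta> + real N * \<alpha>" \<mu> k] \<alpha> \<theta> \<mu>
      by (simp add: H_def add_pos_nonneg)
  qed
  have A0: "?A 0 = 1" using \<mu> by (simp add: moment_fps_nth)
  have "\<forall>N. a N k = H N k"
  proof (induction k rule: less_induct)
    case (less k)
    show ?case
    \<comment> \<open>At k = 0 there is no gap between the exponents k and k / \<alpha>, so this
      coefficient is fixed by normalisation instead.\<close>
    proof (cases "k = 0")
      case True
      then show ?thesis using a0 by (simp add: H_def)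
    next
      case False
      define d where "d N = a N k - H N k" for N
      have step: "d (Suc N) = d N * (1 + (real k / \<alpha>) / (\<theta> / \<alpha> + real N))" for N
      proof -
        \<comment> \<open>By induction the two solutions agree at all indices below k, so only j = 0
          survives, and its coefficient is 1.\<close>
        have "(\<Sum>j=0..k. ?A j * (a (Suc N) (k - j) - H (Suc N) (k - j))) = (\<Sum>j\<in>{0}. ?A j * (a (Suc N) (k - j) - H (Suc N) (k - j)))"
          using less False by (intro sum.mono_neutral_right) auto
        moreover have "d N * (1 + real k / (\<theta> + real N * \<alpha>)) =
            (\<Sum>j=0..k. ?A j * (a (Suc N) (k - j) - H (Suc N) (k - j)))"
          by (simp only: d_def left_diff_distrib right_diff_distrib rec H_rec sum_subtractf)
        ultimately have "d N * (1 + real k / (\<theta> + real N * \<alpha>)) = d (Suc N)"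
          using A0 by (simp add: d_def)
        moreover have "(real k / \<alpha>) / (\<theta> / \<alpha> + real N) = real k / (\<theta> + real N * \<alpha>)"
          using \<alpha> by (simp add: distrib_left mult.commute)
        ultimately show ?thesis by (simp only:)
      qed
      obtain D where D: "\<And>N. \<bar>H N k\<bar> \<le> D * pochhammer (\<theta> / \<alpha> + real N) k"
      proof
        show "\<bar>H N k\<bar> \<le> (\<Sum>i=0..k. \<bar>fps_nth ((moment_fps (- \<alpha>) \<mu> - 1) ^ i) k\<bar>) * pochhammer (\<theta> / \<alpha> + real N) k" for N
          unfolding H_def using False \<alpha> \<theta> by (intro fps_real_powr_growth) (auto intro: add_pos_nonneg)
      qed
      have "\<bar>d N\<bar> \<le> (C k + D) * pochhammer (\<theta> / \<alpha> + real N) k" for N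
        unfolding d_def using bound[of N k] D[of N] by (simp add: algebra_simps)
      moreover have "real k < real k / \<alpha>" using False \<alpha> by (simp add: field_simps)
      ultimately have "d N = 0" for N
        using \<alpha> \<theta> step by (intro zero_if_growth_exceeds_pochhammer[where x = "\<theta> / \<alpha>" and e = "real k / \<alpha>" and k = k]) auto
      then show ?thesis by (simp add: d_def)
    qed
  qed
  then show ?thesis by (simp add: H_def)
qed

text \<open>Composition says little about convergence, so the value is found from the differential equation
  \<open>F H' = b F' H\<close>, which makes \<open>H F\<^sup>-\<^sup>b\<close> constant on \<open>[0, 1]\<close>.\<close>

lemma eval_fps_real_powr:
  fixes F :: "real fps"
  assumes F0: "fps_nth F 0 = 1"
    and rad: "fps_conv_radius F > 1" "fps_conv_radius (fps_real_powr F b) > 1"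
    and pos: "\<And>u. 0 \<le> u \<Longrightarrow> u \<le> 1 \<Longrightarrow> eval_fps F u > 0"
  shows "eval_fps (fps_real_powr F b) 1 = eval_fps F 1 powr b"
proof -
  define f h where "f = eval_fps F" and "h = eval_fps (fps_real_powr F b)"
  define f' h' where "f' = eval_fps (fps_deriv F)" and "h' = eval_fps (fps_deriv (fps_real_powr F b))"
  have lt: "ereal (norm u) < fps_conv_radius F" "ereal (norm u) < fps_conv_radius (fps_real_powr F b)"
     if "0 \<le> u" "u \<le> 1" for u :: real
    using that rad by (auto intro: le_less_trans[of _ 1])
  have ode: "h' u * f u = b * h u * f' u" if u: "0 \<le> u" "u \<le> 1" for u
  proof -
    have l: "ereal (norm u) < fps_conv_radius (fps_deriv F)"
       "ereal (norm u) < fps_conv_radius (fps_deriv (fps_real_powr F b))"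
      using lt[OF u] fps_conv_radius_deriv less_le_trans by blast+
    have l': "ereal (norm u) < fps_conv_radius (fps_const b * fps_real_powr F b)"
      using lt[OF u] fps_conv_radius_mult[of "fps_const b" "fps_real_powr F b"]
      by (auto simp: min_def intro: less_le_trans)
    \<comment> \<open>Multiplication by F replaces the exponent b - 1, for which no radius of
      convergence is known, by b.\<close>
    have "fps_deriv (fps_real_powr F b) * F = fps_const b * (fps_real_powr F (b - 1) * F) * fps_deriv F"
      by (simp add: fps_deriv_fps_real_powr[OF F0] mult_ac)
    then have "fps_deriv (fps_real_powr F b) * F = (fps_const b * fps_real_powr F b) * fps_deriv F"
      by (simp add: fps_real_powr_mult_base[OF F0])
    then have "eval_fps (fps_deriv (fps_real_powr F b) * F) u = eval_fps ((fps_const b * fps_real_powr F b) * fps_deriv F) u"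
      by simp
    then show ?thesis
      using l l' lt[OF u] by (simp add: eval_fps_mult f_def h_def f'_def h'_def)
  qed
  have df: "(f has_real_derivative f' u) (at u)" "(h has_real_derivative h' u) (at u)" if "0 \<le> u" "u \<le> 1" for u
    unfolding f_def f'_def h_def h'_def by (intro has_field_derivative_eval_fps lt that)+
  have "h 1 * f 1 powr (- b) = h 0 * f 0 powr (- b)"
  proof (rule DERIV_isconst_end[where f = "\<lambda>u. h u * f u powr (- b)"])
    show "continuous_on {0..1} (\<lambda>u. h u * f u powr - b)"
      using pos df by (intro continuous_intros DERIV_continuous_on) 
        (auto simp: f_def less_imp_neq[symmetric] intro: DERIV_subset)
    fix u :: real assume u: "0 < u" "u < 1"
    have fu: "f u > 0" using pos u by (simp add: f_def)
    have "((\<lambda>u. h u * f u powr (- b)) has_real_derivative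
        h' u * f u powr (- b) + h u * (- b * f u powr (- b - 1) * f' u)) (at u)"
      using df[of u] u fu by (auto intro!: derivative_eq_intros)
    moreover have "h' u * f u powr (- b) + h u * (- b * f u powr (- b - 1) * f' u) =
       f u powr (- b) / f u * (h' u * f u - b * h u * f' u)"
      using fu by (simp add: powr_diff field_simps)
    ultimately show "((\<lambda>u. h u * f u powr (- b)) has_real_derivative 0) (at u)"
      using ode[of u] u by simp
  qed simp
  moreover have "h 0 = 1" "f 0 = 1" using F0 by (simp_all add: h_def f_def eval_fps_at_0)
  ultimately show ?thesis
    using pos[of 1] by (simp add: f_def h_def powr_minus field_simps)
qed

subsection \<open>Stick breaking\<close>

text \<open>Fubini under independence, used to average over the sticks while the atoms are
  frozen.\<close>

lemma (in prob_space) indep_var_integral: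
  fixes f :: "'b \<times> 'b \<Rightarrow> real"
  assumes ind: "indep_var S X T Y" and f [measurable]: "f \<in> borel_measurable (S \<Otimes>\<^sub>M T)"
    and int: "integrable M (\<lambda>\<omega>. f (X \<omega>, Y \<omega>))"
  shows "(LINT \<omega>|M. f (X \<omega>, Y \<omega>)) = (LINT \<omega>|M. (LINT \<omega>'|M. f (X \<omega>', Y \<omega>)))"
proof -
  have [measurable]: "random_variable S X" "random_variable T Y"
    and eq: "distr M S X \<Otimes>\<^sub>M distr M T Y = distr M (S \<Otimes>\<^sub>M T) (\<lambda>x. (X x, Y x))"
    using ind by (auto simp: indep_var_distribution_eq)
  interpret X: prob_space "distr M S X" by (rule prob_space_distr) measurable
  interpret Y: prob_space "distr M T Y" by (rule prob_space_distr) measurable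
  interpret XY: pair_prob_space "distr M S X" "distr M T Y" ..
  have f': "f \<in> borel_measurable (distr M S X \<Otimes>\<^sub>M distr M T Y)"
    unfolding eq using f by simp
  have f_split: "case_prod (\<lambda>x y. f (x, y)) = f" by auto
  have "(LINT \<omega>|M. f (X \<omega>, Y \<omega>)) = integral\<^sup>L (distr M S X \<Otimes>\<^sub>M distr M T Y) f"
    unfolding eq by (simp add: integral_distr)
  also have "\<dots> = (LINT y|distr M T Y. (LINT x|distr M S X. f (x, y)))"
    by (subst XY.integral_snd) (use int in \<open>simp_all add: f_split eq integrable_distr_eq\<close>)
  also have "\<dots> = (LINT \<omega>|M. (LINT \<omega>'|M. f (X \<omega>', Y \<omega>)))"
    by (subst integral_distr) (auto simp: integral_distr intro!: Bochner_Integration.integral_cong)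
  finally show ?thesis .
qed

text \<open>\<open>indep_var\<close> requires both variables to have the same type, so the head is a constant sequence.\<close>

lemma (in prob_space) indep_vars_head_tail:
  fixes X :: "nat \<Rightarrow> 'a \<Rightarrow> 'b"
  assumes "indep_vars (\<lambda>_. N) X UNIV"
  shows "indep_var (\<Pi>\<^sub>M i\<in>UNIV. N) (\<lambda>\<omega> i. X n \<omega>) (\<Pi>\<^sub>M i\<in>UNIV. N) (\<lambda>\<omega> i. X (Suc n + i) \<omega>)"
proof -
  have "indep_var (PiM {n} (\<lambda>_. N)) (\<lambda>\<omega>. restrict (\<lambda>i. X i \<omega>) {n})
      (PiM {n<..} (\<lambda>_. N)) (\<lambda>\<omega>. restrict (\<lambda>i. X i \<omega>) {n<..})"
    using assms by (rule indep_var_restrict) auto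
  then have "indep_var (\<Pi>\<^sub>M i\<in>UNIV. N) ((\<lambda>g i. g n) \<circ> (\<lambda>\<omega>. restrict (\<lambda>i. X i \<omega>) {n}))
      (\<Pi>\<^sub>M i\<in>UNIV. N) ((\<lambda>g i. g (Suc n + i)) \<circ> (\<lambda>\<omega>. restrict (\<lambda>i. X i \<omega>) {n<..}))"
    by (rule indep_var_compose) (auto intro!: measurable_PiM_single' measurable_component_singleton simp: space_PiM PiE_iff)
  then show ?thesis by (simp add: comp_def)
qed

lemma (in prob_space) indep_var_integral_mult:
  fixes f g :: "'b \<Rightarrow> real"
  assumes ind: "indep_var S X T Y" and "f \<in> borel_measurable S" "g \<in> borel_measurable T"
    and "integrable M (\<lambda>\<omega>. f (X \<omega>))" "integrable M (\<lambda>\<omega>. g (Y \<omega>))"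
  shows "(LINT \<omega>|M. f (X \<omega>) * g (Y \<omega>)) = (LINT \<omega>|M. f (X \<omega>)) * (LINT \<omega>|M. g (Y \<omega>))"
  using indep_var_lebesgue_integral[OF indep_var_compose[OF ind assms(2,3)]] assms by (simp add: comp_def)

section \<open>Weights and weighted sums for fixed sequences\<close>

lemma stick_weight_0 [simp]: "stick_weight v 0 = v 0"
  by (simp add: stick_weight_def)

lemma stick_weight_Suc: "stick_weight v (Suc n) = (1 - v 0) * stick_weight (\<lambda>i. v (Suc i)) n"
  unfolding stick_weight_def by (subst prod.lessThan_Suc_shift) simp

lemma sum_stick_weight: "(\<Sum>n<k. stick_weight v n) = 1 - (\<Prod>i<k. 1 - v i)"
  by (induction k) (simp_all add: stick_weight_def algebra_simps)

text \<open>The functional of the process as a function of two plain sequences, so that independence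
  of the random sequences can be applied to it on the product space.\<close>

definition stick_sum :: "(real \<Rightarrow> real) \<Rightarrow> (nat \<Rightarrow> real) \<Rightarrow> (nat \<Rightarrow> real) \<Rightarrow> real" where
  "stick_sum f v x = (\<Sum>n. stick_weight v n * f (x n))"

lemma stick_weight_nonneg: "(\<And>i. v i \<in> {0..1}) \<Longrightarrow> 0 \<le> stick_weight v n"
  unfolding stick_weight_def by (auto intro!: mult_nonneg_nonneg prod_nonneg)

text \<open>Pointwise only an inequality is available, since the remaining stick, a product of the
  factors 1 - v i, need not tend to 0. Equality comes almost surely in \<open>X_one\<close>.\<close>

lemma
  assumes v: "\<And>i. v i \<in> {0..1}"
  shows summable_stick_weight: "summable (stick_weight v)"
    and suminf_stick_weight_le: "suminf (stick_weight v) \<le> 1"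
proof -
  have le: "(\<Sum>n<k. stick_weight v n) \<le> 1" for k
    using v by (simp add: sum_stick_weight prod_nonneg)
  show s: "summable (stick_weight v)"
    using le by (intro summableI_nonneg_bounded[where x = 1] stick_weight_nonneg v)
  show "suminf (stick_weight v) \<le> 1"
    using s le by (rule suminf_le_const)
qed

lemma
  assumes v: "\<And>i. v i \<in> {0..1}" and f: "\<And>x. \<bar>f x\<bar> \<le> B"
  shows summable_stick_sum: "summable (\<lambda>n. stick_weight v n * f (x n))"
    and abs_stick_sum_le: "\<bar>stick_sum f v x\<bar> \<le> B"
proof -
  have le: "norm (stick_weight v n * f (x n)) \<le> stick_weight v n * B" for n
    using f stick_weight_nonneg[of v n] v by (auto simp: abs_mult intro!: mult_left_mono)
  have s: "summable (\<lambda>n. stick_weight v n * B)" by (intro summable_mult2 summable_stick_weight v)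
  have n: "summable (\<lambda>n. norm (stick_weight v n * f (x n)))"
    using le by (intro summable_comparison_test[OF _ s]) auto
  then show "summable (\<lambda>n. stick_weight v n * f (x n))" by (rule summable_norm_cancel)
  have "\<bar>stick_sum f v x\<bar> \<le> (\<Sum>n. norm (stick_weight v n * f (x n)))"
    unfolding stick_sum_def using summable_norm[OF n] by simp
  also have "\<dots> \<le> (\<Sum>n. stick_weight v n * B)" by (intro suminf_le le n s)
  also have "\<dots> = suminf (stick_weight v) * B" by (intro suminf_mult2[symmetric] summable_stick_weight v)
  also have "\<dots> \<le> 1 * B"
    using f[of 0] by (intro mult_right_mono suminf_stick_weight_le v) auto
  finally show "\<bar>stick_sum f v x\<bar> \<le> B" by simp
qed

lemma stick_sum_unfold:
  assumes v: "\<And>i. v i \<in> {0..1}" and f: "\<And>x. \<bar>f x\<bar> \<le> B"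
  shows "stick_sum f v x = v 0 * f (x 0) + (1 - v 0) * stick_sum f (\<lambda>i. v (Suc i)) (\<lambda>i. x (Suc i))"
proof -
  have "summable (\<lambda>n. stick_weight v n * f (x n))" by (rule summable_stick_sum[OF v f])
  from suminf_split_head[OF this]
  have "stick_sum f v x = v 0 * f (x 0) + (\<Sum>n. stick_weight v (Suc n) * f (x (Suc n)))"
    unfolding stick_sum_def by simp
  also have "(\<Sum>n. stick_weight v (Suc n) * f (x (Suc n))) =
      (1 - v 0) * stick_sum f (\<lambda>i. v (Suc i)) (\<lambda>i. x (Suc i))"
    unfolding stick_weight_Suc mult.assoc stick_sum_def
    by (intro suminf_mult summable_stick_sum[where B = B] v f)
  finally show ?thesis .
qed

lemma stick_sum_linear:
  assumes v: "\<And>i. v i \<in> {0..1}" and f: "\<And>x. \<bar>f x\<bar> \<le> B" and g: "\<And>x. \<bar>g x\<bar> \<le> C"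
  shows "stick_sum (\<lambda>y. a * f y + b * g y) v x = a * stick_sum f v x + b * stick_sum g v x"
proof -
  note s = summable_stick_sum[where v = v and x = x]
  have "(\<lambda>n. a * (stick_weight v n * f (x n)) + b * (stick_weight v n * g (x n))) sums
      (a * stick_sum f v x + b * stick_sum g v x)"
    unfolding stick_sum_def by (intro sums_add sums_mult summable_sums s[where B = B] s[where B = C] v f g)
  then show ?thesis unfolding stick_sum_def by (simp add: sums_iff algebra_simps)
qed

lemma measurable_stick_sum [measurable (raw)]:
  assumes [measurable]: "f \<in> borel_measurable borel"
    "\<And>n. (\<lambda>\<omega>. v \<omega> n) \<in> borel_measurable N" "\<And>n. (\<lambda>\<omega>. x \<omega> n) \<in> borel_measurable N"
  shows "(\<lambda>\<omega>. stick_sum f (v \<omega>) (x \<omega>)) \<in> borel_measurable N"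
  unfolding stick_sum_def stick_weight_def by measurable

section \<open>Moments of a single stick\<close>

lemma pochhammer_Gamma_real:
  assumes "a > (0::real)"
  shows "Gamma (a + real n) = pochhammer a n * Gamma a"
proof -
  have "a \<notin> \<int>\<^sub>\<le>\<^sub>0" using assms by (auto elim!: nonpos_Ints_cases)
  then show ?thesis
    using pochhammer_Gamma[of a n] Gamma_real_pos[OF assms] by (simp add: field_simps)
qed

lemma (in prob_space) beta_moments:
  assumes D: "distributed M lborel X (beta_density a b)" and ab: "a > 0" "b > 0"
  shows "(LINT \<omega>|M. X \<omega> ^ i * (1 - X \<omega>) ^ j) = pochhammer a i * pochhammer b j / pochhammer (a + b) (i + j)"
proof -
  have B: "Beta a b > 0" using ab by (simp add: Beta_def Gamma_real_pos)
  have eq: "beta_density a b x * (x ^ i * (1 - x) ^ j) =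
     indicator {0..1} x *\<^sub>R (x powr (a + real i - 1) * (1 - x) powr (b + real j - 1)) / Beta a b" for x
  proof (cases "0 < x \<and> x < 1")
    case True
    have "x powr (a + real i - 1) = x powr (a - 1) * x ^ i" "(1 - x) powr (b + real j - 1) = (1 - x) powr (b - 1) * (1 - x) ^ j"
      using True powr_add[of x "a - 1" "real i"] powr_add[of "1 - x" "b - 1" "real j"]
      by (simp_all add: powr_realpow algebra_simps)
    then show ?thesis using True by (simp add: beta_density_def)
  next
    case False
    \<comment> \<open>At the endpoints the right side vanishes as well, by the convention that 0
      \<open>powr\<close> anything is 0.\<close>
    then show ?thesis by (cases "x \<in> {0..1}") (auto simp: beta_density_def)
  qed
  have "(LINT \<omega>|M. X \<omega> ^ i * (1 - X \<omega>) ^ j) = (LINT x|lborel. beta_density a b x * (x ^ i * (1 - x) ^ j))"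
    using B by (intro distributed_integral[OF D, symmetric]) (auto simp: beta_density_def)
  also have "\<dots> = (LINT x:{0..1}|lborel. x powr (a + real i - 1) * (1 - x) powr (b + real j - 1)) / Beta a b"
    unfolding eq set_lebesgue_integral_def by simp
  also have "(LINT x:{0..1}|lborel. x powr (a + real i - 1) * (1 - x) powr (b + real j - 1)) = Beta (a + real i) (b + real j)"
  proof (subst set_borel_integral_eq_integral(2))
    show "set_integrable lborel {0..1} (\<lambda>x. x powr (a + real i - 1) * (1 - x) powr (b + real j - 1))"
      using ab by (intro integrable_Beta) auto
    show "integral {0..1} (\<lambda>x. x powr (a + real i - 1) * (1 - x) powr (b + real j - 1)) = Beta (a + real i) (b + real j)"
      using ab by (intro integral_unique has_integral_Beta_real) auto
  qed
  also have "\<dots> = pochhammer a i * pochhammer b j * Beta a b / pochhammer (a + b) (i + j)"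
  proof -
    have "a + real i + (b + real j) = (a + b) + real (i + j)" by simp
    then show ?thesis
      using ab pochhammer_Gamma_real[of a i] pochhammer_Gamma_real[of b j] pochhammer_Gamma_real[of "a + b" "i + j"]
      unfolding Beta_def by (simp add: field_simps)
  qed
  finally show ?thesis using B by simp
qed

text \<open>\<open>V_range\<close> is required at every \<omega>, so that the series for bounded
  functions converge without exceptional null sets; for the process itself this is arranged by
  clamping the sticks.\<close>

locale stick_breaking = prob_space M for M :: "'a measure" +
  fixes \<alpha> \<theta> :: real and G :: "real measure" and V \<xi> :: "nat \<Rightarrow> 'a \<Rightarrow> real"
  assumes \<alpha>: "0 < \<alpha>" "\<alpha> < 1" and \<theta>: "0 < \<theta>"
    and V_indep: "indep_vars (\<lambda>_. borel) V UNIV"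
    and V_distributed: "distributed M lborel (V n) (beta_density (1 - \<alpha>) (\<theta> + real (n + 1) * \<alpha>))"
    and V_range: "V n \<omega> \<in> {0..1}"
    and \<xi>_indep: "indep_vars (\<lambda>_. borel) \<xi> UNIV"
    and \<xi>_distr: "distr M borel (\<xi> n) = G"
    and V_\<xi>_indep: "indep_var (\<Pi>\<^sub>M n\<in>UNIV. borel) (\<lambda>\<omega> n. V n \<omega>) (\<Pi>\<^sub>M n\<in>UNIV. borel) (\<lambda>\<omega> n. \<xi> n \<omega>)"
begin

lemma V_measurable [measurable]: "V n \<in> borel_measurable M"
  using V_indep by (auto simp: indep_vars_def)

lemma \<xi>_measurable [measurable]: "\<xi> n \<in> borel_measurable M"
  using \<xi>_indep by (auto simp: indep_vars_def)

lemma sets_G [measurable_cong, simp]: "sets G = sets borel" and space_G [simp]: "space G = UNIV"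
  using \<xi>_distr[of 0] by auto

sublocale G: prob_space G
  using prob_space_distr[OF \<xi>_measurable[of 0]] by (simp add: \<xi>_distr)

lemma integral_\<xi>: "f \<in> borel_measurable borel \<Longrightarrow> (LINT \<omega>|M. f (\<xi> n \<omega>)) = (LINT x|G. f x :: real)"
  using integral_distr[of "\<xi> n" M borel f] by (simp add: \<xi>_distr)

text \<open>The functional of the process that is left after the first \<open>N\<close> sticks; it has
  the parameters \<open>\<alpha>\<close> and \<open>\<theta> + N \<alpha>\<close>.\<close>

definition X :: "(real \<Rightarrow> real) \<Rightarrow> nat \<Rightarrow> 'a \<Rightarrow> real" where
  "X f N \<omega> = stick_sum f (\<lambda>i. V (N + i) \<omega>) (\<lambda>i. \<xi> (N + i) \<omega>)"

lemma measurable_X [measurable]: "f \<in> borel_measurable borel \<Longrightarrow> X f N \<in> borel_measurable M"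
  unfolding X_def[abs_def] by (rule measurable_stick_sum) auto

lemma abs_X_le: "(\<And>x. \<bar>f x\<bar> \<le> B) \<Longrightarrow> \<bar>X f N \<omega>\<bar> \<le> B"
  unfolding X_def by (intro abs_stick_sum_le V_range)

lemma X_unfold: "(\<And>x. \<bar>f x\<bar> \<le> B) \<Longrightarrow> X f N \<omega> = V N \<omega> * f (\<xi> N \<omega>) + (1 - V N \<omega>) * X f (Suc N) \<omega>"
  unfolding X_def by (subst stick_sum_unfold[OF V_range]) auto

lemma X_linear:
  assumes "\<And>x. \<bar>f x\<bar> \<le> B" "\<And>x. \<bar>g x\<bar> \<le> C"
  shows "X (\<lambda>y. a * f y + b * g y) N \<omega> = a * X f N \<omega> + b * X g N \<omega>"
  unfolding X_def by (rule stick_sum_linear[OF V_range assms])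

text \<open>The first stick, the first atom and the later process separate. Independence is given
  only within each sequence and between the two, so the sticks are averaged first with the atoms
  frozen, where the first stick splits off; then the first atom is split from the later
  ones.\<close>

lemma expectation_split:
  fixes a b :: "real \<Rightarrow> real"
  assumes [measurable]: "a \<in> borel_measurable borel" "b \<in> borel_measurable borel" "f \<in> borel_measurable borel"
    and a: "\<And>x. x \<in> {0..1} \<Longrightarrow> \<bar>a x\<bar> \<le> A" and b: "\<And>x. \<bar>b x\<bar> \<le> B" and f: "\<And>x. \<bar>f x\<bar> \<le> 1"
  shows "(LINT \<omega>|M. a (V N \<omega>) * b (\<xi> N \<omega>) * X f (Suc N) \<omega> ^ i)
    = (LINT \<omega>|M. a (V N \<omega>)) * (LINT x|G. b x) * (LINT \<omega>|M. X f (Suc N) \<omega> ^ i)"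
proof -
  define S where "S = (\<Pi>\<^sub>M n\<in>(UNIV :: nat set). (borel :: real measure))"
  define c where "c v x = stick_sum f v x ^ i" for v x
  have c_meas [measurable]: "(\<lambda>p. c (fst p) (snd p)) \<in> borel_measurable (S \<Otimes>\<^sub>M S)"
    unfolding c_def S_def by measurable
  have head: "(\<lambda>v. g (v 0)) \<in> borel_measurable S" if "g \<in> borel_measurable borel" for g :: "real \<Rightarrow> real"
    using that unfolding S_def by measurable
  define V' where "V' \<omega> = (\<lambda>n. V (Suc N + n) \<omega>)" for \<omega>
  define \<xi>' where "\<xi>' \<omega> = (\<lambda>n. \<xi> (Suc N + n) \<omega>)" for \<omega>
  have VV': "indep_var S (\<lambda>\<omega> i. V N \<omega>) S V'" and \<xi>\<xi>': "indep_var S (\<lambda>\<omega> i. \<xi> N \<omega>) S \<xi>'"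
    unfolding S_def V'_def[abs_def] \<xi>'_def[abs_def] by (intro indep_vars_head_tail V_indep \<xi>_indep)+
  have [measurable]: "V' \<in> M \<rightarrow>\<^sub>M S" "\<xi>' \<in> M \<rightarrow>\<^sub>M S"
    using VV' \<xi>\<xi>' by (auto dest: indep_var_rv2)
  have c_le: "\<bar>c (V' \<omega>) x\<bar> \<le> 1" for \<omega> x
    using abs_stick_sum_le[of "V' \<omega>" f 1 x] V_range f
    by (auto simp: c_def V'_def power_abs intro!: power_le_one)
  have a_int: "integrable M (\<lambda>\<omega>. a (V N \<omega>))" 
    using a V_range by (intro integrable_const_bound[of _ A]) auto
  have b_int: "integrable M (\<lambda>\<omega>. b (\<xi> N \<omega>))" 
    using b by (intro integrable_const_bound[of _ B]) auto
  have c1 [measurable]: "(\<lambda>v. c v y) \<in> borel_measurable S" for y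
    unfolding c_def S_def by measurable
  have c_int: "integrable M (\<lambda>\<omega>. c (V' \<omega>) y)" for y
    using c_le by (intro integrable_const_bound[of _ 1]) auto
  \<comment> \<open>The power of the later functional averaged over the sticks, at fixed atoms
    \<open>y\<close>.\<close>
  define K where "K y = (LINT \<omega>|M. c (V' \<omega>) y)" for y
  have [measurable]: "(\<lambda>(y, \<omega>). c (V' \<omega>) y) \<in> borel_measurable (S \<Otimes>\<^sub>M M)"
  proof -
    have "(\<lambda>q. (V' (snd q), fst q)) \<in> S \<Otimes>\<^sub>M M \<rightarrow>\<^sub>M S \<Otimes>\<^sub>M S" by measurable
    from measurable_compose[OF this c_meas] show ?thesis by (simp add: case_prod_beta)
  qed
  have K_meas [measurable]: "K \<in> borel_measurable S"
    unfolding K_def[abs_def] by measurable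
  have K_le: "\<bar>K y\<bar> \<le> 1" for y
  proof -
    have "\<bar>K y\<bar> \<le> (LINT \<omega>|M. \<bar>c (V' \<omega>) y\<bar>)" unfolding K_def by (rule integral_abs_bound)
    also have "\<dots> \<le> (LINT \<omega>|M. 1)" using c_le c_int by (intro integral_mono integrable_abs) auto
    finally show ?thesis by (simp add: prob_space)
  qed
  have K_int: "integrable M (\<lambda>\<omega>. K (\<xi>' \<omega>))"
    using K_le by (intro integrable_const_bound[of _ 1]) auto
  have swap: "(LINT \<omega>|M. g (V N \<omega>) * h (\<xi> N \<omega>) * c (V' \<omega>) (\<xi>' \<omega>)) =
      (LINT \<omega>|M. (LINT \<omega>'|M. g (V N \<omega>') * h (\<xi> N \<omega>) * c (V' \<omega>') (\<xi>' \<omega>)))"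
    if [measurable]: "g \<in> borel_measurable borel" "h \<in> borel_measurable borel"
      and g: "\<And>x. x \<in> {0..1} \<Longrightarrow> \<bar>g x\<bar> \<le> A'" and h: "\<And>x. \<bar>h x\<bar> \<le> B'" for g h :: "real \<Rightarrow> real" and A' B'
  proof -
    let ?F = "\<lambda>p. g (fst p N) * h (snd p N) * c (\<lambda>n. fst p (Suc N + n)) (\<lambda>n. snd p (Suc N + n))"
    have AB': "0 \<le> A'" "0 \<le> B'" using g[of 0] h[of 0] by auto
    have m: "?F \<in> borel_measurable ((\<Pi>\<^sub>M n\<in>UNIV. borel) \<Otimes>\<^sub>M (\<Pi>\<^sub>M n\<in>UNIV. borel))"
      unfolding c_def by measurable
    have "integrable M (\<lambda>\<omega>. g (V N \<omega>) * h (\<xi> N \<omega>) * c (V' \<omega>) (\<xi>' \<omega>))"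
    proof (rule integrable_const_bound[of _ "A' * B' * 1"])
      show "AE x in M. norm (g (V N x) * h (\<xi> N x) * c (V' x) (\<xi>' x)) \<le> A' * B' * 1"
        using g[OF V_range] h c_le AB' unfolding real_norm_def abs_mult by (intro AE_I2 mult_mono) auto
      have "(\<lambda>\<omega>. c (V' \<omega>) (\<xi>' \<omega>)) \<in> borel_measurable M"
        unfolding c_def V'_def \<xi>'_def by measurable
      then show "(\<lambda>x. g (V N x) * h (\<xi> N x) * c (V' x) (\<xi>' x)) \<in> borel_measurable M" by measurable
    qed
    then show ?thesis
      using indep_var_integral[OF V_\<xi>_indep m] by (simp add: V'_def \<xi>'_def)
  qed
  have "(LINT \<omega>|M. a (V N \<omega>) * b (\<xi> N \<omega>) * c (V' \<omega>) (\<xi>' \<omega>)) =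
      (LINT \<omega>|M. (LINT \<omega>'|M. a (V N \<omega>') * b (\<xi> N \<omega>) * c (V' \<omega>') (\<xi>' \<omega>)))"
    by (rule swap) (use a b in auto)
  also have "\<dots> = (LINT \<omega>|M. (LINT \<omega>|M. a (V N \<omega>)) * (b (\<xi> N \<omega>) * K (\<xi>' \<omega>)))"
  proof (rule Bochner_Integration.integral_cong[OF refl])
    fix \<omega>
    have "(LINT \<omega>'|M. a (V N \<omega>') * b (\<xi> N \<omega>) * c (V' \<omega>') (\<xi>' \<omega>)) =
       (LINT \<omega>'|M. b (\<xi> N \<omega>) * (a (V N \<omega>') * c (V' \<omega>') (\<xi>' \<omega>)))" by (simp add: mult_ac)
    also have "\<dots> = b (\<xi> N \<omega>) * ((LINT \<omega>|M. a (V N \<omega>)) * K (\<xi>' \<omega>))"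
      unfolding K_def using indep_var_integral_mult[OF VV', where f = \<open>\<lambda>v. a (v 0)\<close> and g = \<open>\<lambda>v. c v (\<xi>' \<omega>)\<close>] head[OF assms(1)] c1 a_int c_int by simp
    finally show "(LINT \<omega>'|M. a (V N \<omega>') * b (\<xi> N \<omega>) * c (V' \<omega>') (\<xi>' \<omega>)) =
      (LINT \<omega>|M. a (V N \<omega>)) * (b (\<xi> N \<omega>) * K (\<xi>' \<omega>))" by (simp add: mult_ac)
  qed
  also have "\<dots> = (LINT \<omega>|M. a (V N \<omega>)) * ((LINT x|G. b x) * (LINT \<omega>|M. K (\<xi>' \<omega>)))"
    using indep_var_integral_mult[OF \<xi>\<xi>', where f = \<open>\<lambda>v. b (v 0)\<close> and g = K] head[OF assms(2)] K_meas b_int K_int by (simp add: integral_\<xi>)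
  \<comment> \<open>The same exchange with both head factors equal to 1, read backwards, restores
    the full moment of the later functional.\<close>
  also have "(LINT \<omega>|M. K (\<xi>' \<omega>)) = (LINT \<omega>|M. c (V' \<omega>) (\<xi>' \<omega>))"
    using swap[of "\<lambda>_. 1" "\<lambda>_. 1" 1 1] by (simp add: K_def)
  finally show ?thesis by (simp add: c_def X_def V'_def \<xi>'_def mult_ac)
qed

end

subsection \<open>The Markov--Krein identity\<close>

context stick_breaking
begin

lemma X_moments:
  assumes f [measurable]: "f \<in> borel_measurable borel" and f_le: "\<And>x. \<bar>f x\<bar> \<le> 1"
  shows "pochhammer (\<theta> + real N * \<alpha>) k / fact k * (LINT \<omega>|M. X f N \<omega> ^ k) =
    fps_nth (fps_real_powr (moment_fps (- \<alpha>) (\<lambda>j. LINT x|G. f x ^ j)) (- (\<theta> / \<alpha> + real N))) k"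
proof -
  define \<mu> where "\<mu> j = (LINT x|G. f x ^ j)" for j
  define m where "m N k = (LINT \<omega>|M. X f N \<omega> ^ k)" for N k
  define a where "a N k = pochhammer (\<theta> + real N * \<alpha>) k / fact k * m N k" for N k
  have tpos: "\<theta> + real N * \<alpha> > 0" for N using \<alpha> \<theta> by (simp add: add_pos_nonneg)
  have X_le: "\<bar>X f N \<omega>\<bar> \<le> 1" for N \<omega> by (rule abs_X_le) (rule f_le)
  have m_rec: "m N k = (\<Sum>j\<le>k. real (k choose j) *
      (pochhammer (1 - \<alpha>) j * pochhammer (\<theta> + real (Suc N) * \<alpha>) (k - j) / pochhammer (\<theta> + real N * \<alpha> + 1) k) *
      \<mu> j * m (Suc N) (k - j))" for N k
  proof -
    let ?t = "\<lambda>j \<omega>. V N \<omega> ^ j * (1 - V N \<omega>) ^ (k - j) * f (\<xi> N \<omega>) ^ j * X f (Suc N) \<omega> ^ (k - j)"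
    have v: "\<bar>x ^ j * (1 - x) ^ i\<bar> \<le> 1" if "x \<in> {0..1}" for x :: real and i j
      using that by (auto simp: abs_mult power_abs intro!: mult_le_one power_le_one)
    have fj: "\<bar>f x ^ j\<bar> \<le> 1" for x j using f_le by (auto simp: power_abs intro!: power_le_one)
    have int: "integrable M (?t j)" for j
    proof (rule integrable_const_bound[of _ 1])
      have "\<bar>V N \<omega> ^ j * (1 - V N \<omega>) ^ (k - j)\<bar> \<le> 1" for \<omega>
        by (rule v[OF V_range])
      then have "\<bar>?t j \<omega>\<bar> \<le> 1" for \<omega>
        using fj X_le[of "Suc N" \<omega>]
        unfolding abs_mult[of "_ * _"] by (intro mult_le_one) (auto simp: power_abs intro!: power_le_one)
      then show "AE \<omega> in M. norm (?t j \<omega>) \<le> 1" by simp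
    qed measurable
    have t: "(LINT \<omega>|M. ?t j \<omega>) = pochhammer (1 - \<alpha>) j * pochhammer (\<theta> + real (Suc N) * \<alpha>) (k - j) /
        pochhammer (\<theta> + real N * \<alpha> + 1) k * \<mu> j * m (Suc N) (k - j)" if "j \<le> k" for j
    proof -
      have "(LINT \<omega>|M. ?t j \<omega>) = (LINT \<omega>|M. V N \<omega> ^ j * (1 - V N \<omega>) ^ (k - j)) * \<mu> j * m (Suc N) (k - j)"
        unfolding \<mu>_def m_def
        using expectation_split[where a = "\<lambda>v. v ^ j * (1 - v) ^ (k - j)" and b = "\<lambda>x. f x ^ j" and f = f
            and A = 1 and B = 1 and N = N and i = "k - j"] v fj f_le by simp
      also have "(LINT \<omega>|M. V N \<omega> ^ j * (1 - V N \<omega>) ^ (k - j)) =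
        pochhammer (1 - \<alpha>) j * pochhammer (\<theta> + real (N + 1) * \<alpha>) (k - j) /
        pochhammer ((1 - \<alpha>) + (\<theta> + real (N + 1) * \<alpha>)) (j + (k - j))"
        using \<alpha> tpos[of "N + 1"] by (intro beta_moments[OF V_distributed]) auto
      \<comment> \<open>With t = \<theta> + N \<alpha> the beta parameters add up to t + 1. Since t
        (t + 1)_k = (t)_k (t + k), normalising by (t)_k later produces the factor 1 + k / t.\<close>
      also have "(1 - \<alpha>) + (\<theta> + real (N + 1) * \<alpha>) = \<theta> + real N * \<alpha> + 1" by (simp add: algebra_simps)
      finally show ?thesis using that by simp
    qed
    have "m N k = (LINT \<omega>|M. (\<Sum>j\<le>k. real (k choose j) * ?t j \<omega>))"
      unfolding m_def
    proof (rule Bochner_Integration.integral_cong[OF refl])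
      fix \<omega>
      show "X f N \<omega> ^ k = (\<Sum>j\<le>k. real (k choose j) * ?t j \<omega>)"
        unfolding X_unfold[of f, OF f_le, of N \<omega>] binomial_ring
        by (intro sum.cong refl) (simp add: power_mult_distrib mult_ac)
    qed
    also have "\<dots> = (\<Sum>j\<le>k. real (k choose j) * (LINT \<omega>|M. ?t j \<omega>))"
      using int by (simp add: integral_sum)
    also have "\<dots> = (\<Sum>j\<le>k. real (k choose j) *
      (pochhammer (1 - \<alpha>) j * pochhammer (\<theta> + real (Suc N) * \<alpha>) (k - j) / pochhammer (\<theta> + real N * \<alpha> + 1) k) *
      \<mu> j * m (Suc N) (k - j))"
      by (intro sum.cong refl) (simp add: t)
    finally show ?thesis .
  qed
  have "a N k = fps_nth (fps_real_powr (moment_fps (- \<alpha>) \<mu>) (- (\<theta> / \<alpha> + real N))) k"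
  proof (rule fps_real_powr_unique[OF \<alpha> \<theta>, where C = "\<lambda>k. 1 / fact k"])
    show "\<mu> 0 = 1" by (simp add: \<mu>_def G.prob_space[simplified])
    show "a N 0 = 1" for N by (simp add: a_def m_def prob_space)
    show "\<bar>a N k\<bar> \<le> 1 / fact k * pochhammer (\<theta> / \<alpha> + real N) k" for N k
    proof -
      have "\<bar>m N k\<bar> \<le> (LINT \<omega>|M. \<bar>X f N \<omega> ^ k\<bar>)" unfolding m_def by (rule integral_abs_bound)
      also have "\<dots> \<le> (LINT \<omega>|M. 1)"
        using X_le by (intro integral_mono integrable_const_bound[of _ 1] AE_I2)
          (auto simp: power_abs intro!: power_le_one)
      finally have "\<bar>m N k\<bar> \<le> 1" by (simp add: prob_space)
      \<comment> \<open>Dividing \<theta> + N \<alpha> by \<alpha> < 1 only increases it, and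
        \<theta> / \<alpha> + N is the parameter that advances by 1 with N, as the growth bound
        requires.\<close>
      moreover have "pochhammer (\<theta> + real N * \<alpha>) k \<le> pochhammer (\<theta> / \<alpha> + real N) k"
        unfolding pochhammer_prod
      proof (intro prod_mono conjI)
        fix i
        have "\<theta> * \<alpha> \<le> \<theta> * 1" "real N * \<alpha> \<le> real N * 1" using \<alpha> \<theta> by (intro mult_left_mono; simp)+
        then show "\<theta> + real N * \<alpha> + real i \<le> \<theta> / \<alpha> + real N + real i"
          using \<alpha> by (intro add_mono) (auto simp: field_simps)
        show "0 \<le> \<theta> + real N * \<alpha> + real i" using tpos[of N] by simp
      qed
      moreover have "0 < pochhammer (\<theta> + real N * \<alpha>) k" using tpos by (intro pochhammer_pos)
      ultimately have "pochhammer (\<theta> + real N * \<alpha>) k * \<bar>m N k\<bar> \<le> pochhammer (\<theta> / \<alpha> + real N) k * 1"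
        by (intro mult_mono) auto
      moreover have "\<bar>a N k\<bar> = pochhammer (\<theta> + real N * \<alpha>) k * \<bar>m N k\<bar> / fact k"
        using \<open>0 < pochhammer (\<theta> + real N * \<alpha>) k\<close> by (simp add: a_def abs_mult)
      ultimately show ?thesis by (simp add: divide_right_mono)
    qed
    show "a N k * (1 + real k / (\<theta> + real N * \<alpha>)) =
        (\<Sum>j=0..k. fps_nth (moment_fps (1 - \<alpha>) \<mu>) j * a (Suc N) (k - j))" for N k
    proof -
      let ?t = "\<theta> + real N * \<alpha>"
      have P: "pochhammer (?t + 1) k > 0" using tpos[of N] by (intro pochhammer_pos) auto
      have "?t * pochhammer (?t + 1) k = pochhammer ?t k * (?t + real k)"
        using pochhammer_rec[of ?t k] pochhammer_rec'[of ?t k] by (simp add: mult.commute)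
      then have "pochhammer ?t k * (1 + real k / ?t) = pochhammer (?t + 1) k"
        using tpos[of N] by (simp add: field_simps)
      then have "a N k * (1 + real k / ?t) = pochhammer (?t + 1) k * m N k / fact k"
        by (simp add: a_def mult_ac flip: times_divide_eq_left)
      also have "\<dots> = (\<Sum>j\<le>k. pochhammer (1 - \<alpha>) j / fact j * \<mu> j *
          (pochhammer (\<theta> + real (Suc N) * \<alpha>) (k - j) / fact (k - j) * m (Suc N) (k - j)))"
        unfolding m_rec[of N k] sum_distrib_left sum_divide_distrib
        using P by (intro sum.cong refl) (simp add: binomial_fact)
      also have "\<dots> = (\<Sum>j=0..k. fps_nth (moment_fps (1 - \<alpha>) \<mu>) j * a (Suc N) (k - j))"
        by (simp add: a_def moment_fps_nth atLeast0AtMost)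
      finally show ?thesis .
    qed
  qed
  then show ?thesis by (simp only: a_def m_def \<mu>_def[abs_def])
qed

lemma X_one: "AE \<omega> in M. X (\<lambda>_. 1) 0 \<omega> = 1"
proof -
  \<comment> \<open>For f = 1 the integral over \<open>G\<close> is (1 - u)^\<alpha>, with linear
    coefficient -\<alpha>; its power -\<theta> / \<alpha> therefore has linear coefficient
    \<theta>.\<close>
  have "\<theta> * (LINT \<omega>|M. X (\<lambda>_. 1) 0 \<omega>) = \<theta>"
    using X_moments[of "\<lambda>_. 1" 0 1] \<alpha>
    by (simp add: fps_real_powr_def fps_compose_nth moment_fps_nth G.prob_space[simplified])
  then have E: "(LINT \<omega>|M. X (\<lambda>_. 1) 0 \<omega>) = 1" using \<theta> by simp
  have le: "\<bar>X (\<lambda>_. 1) 0 \<omega>\<bar> \<le> 1" for \<omega> by (rule abs_X_le) simp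
  have int: "integrable M (X (\<lambda>_. 1) 0)"
    using le by (intro integrable_const_bound[of _ 1]) auto
  have "(LINT \<omega>|M. 1 - X (\<lambda>_. 1) 0 \<omega>) = 0" using E int by (simp add: prob_space)
  moreover have "0 \<le> 1 - X (\<lambda>_. 1) 0 \<omega>" for \<omega> using le[of \<omega>] by simp
  ultimately have "AE \<omega> in M. 1 - X (\<lambda>_. 1) 0 \<omega> = 0"
    using int by (subst integral_nonneg_eq_0_iff_AE[symmetric]) auto
  then show ?thesis by eventually_elim simp
qed

text \<open>The strict bound r < 1 makes both series converge up to 1 / r > 1, so u = 1 is an
  interior point and \<open>eval_fps_real_powr\<close> applies there.\<close>

lemma expectation_one_minus_X_powr:
  assumes f [measurable]: "f \<in> borel_measurable borel" and f_le: "\<And>x. \<bar>f x\<bar> \<le> r" and r: "0 < r" "r < 1"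
  shows "(LINT \<omega>|M. (1 - X f 0 \<omega>) powr (- \<theta>)) = (LINT x|G. (1 - f x) powr \<alpha>) powr (- \<theta> / \<alpha>)"
proof -
  define F where "F = moment_fps (- \<alpha>) (\<lambda>j. LINT x|G. f x ^ j)"
  let ?H = "fps_real_powr F (- \<theta> / \<alpha>)"
  have f1: "\<bar>f x\<bar> \<le> 1" for x using f_le[of x] r by simp
  have H_nth: "fps_nth ?H k = pochhammer \<theta> k / fact k * (LINT \<omega>|M. X f 0 \<omega> ^ k)" for k
    using X_moments[OF f f1, of 0 k] by (simp add: F_def)
  have H: "(\<lambda>k. fps_nth ?H k * u ^ k) sums (LINT \<omega>|M. (1 - u * X f 0 \<omega>) powr (- \<theta>))"
    if "\<bar>u\<bar> < 1 / r" for u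
    unfolding H_nth using expectation_binomial_sums[of "\<lambda>_. 1" "X f 0" 1 r u \<theta>] abs_X_le[of f r] f_le that r
    by (simp add: field_simps)
  have I: "(\<lambda>k. fps_nth F k * u ^ k) sums (LINT x|G. (1 - u * f x) powr \<alpha>)"
    if "\<bar>u\<bar> < 1 / r" for u
    unfolding F_def moment_fps_nth using G.expectation_binomial_sums[of "\<lambda>_. 1" f 1 r u "- \<alpha>"] f_le that r
    by (simp add: field_simps)
  have r1: "ereal (1 / r) > 1" using r by simp
  have rad: "ereal (1 / r) \<le> fps_conv_radius ?H" "ereal (1 / r) \<le> fps_conv_radius F"
    using fps_conv_radius_geI[of "1 / r" "fps_nth ?H"] fps_conv_radius_geI[of "1 / r" "fps_nth F"] H I r
    by (auto simp: sums_iff fps_nth_inverse)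
  have "eval_fps ?H 1 = eval_fps F 1 powr (- \<theta> / \<alpha>)"
  proof (rule eval_fps_real_powr)
    show "fps_nth F 0 = 1" by (simp add: F_def moment_fps_nth G.prob_space[simplified])
    show "fps_conv_radius F > 1" "fps_conv_radius ?H > 1" by (rule less_le_trans[OF r1 rad(2)], rule less_le_trans[OF r1 rad(1)])
    show "0 < eval_fps F u" if u: "0 \<le> u" "u \<le> 1" for u
    proof -
      have uf: "\<bar>u * f x\<bar> \<le> r" for x
        unfolding abs_mult using mult_mono[of "\<bar>u\<bar>" 1 "\<bar>f x\<bar>" r] u f_le by auto
      have b: "(1 - r) powr \<alpha> \<le> (1 - u * f x) powr \<alpha>" "(1 - u * f x) powr \<alpha> \<le> 2 powr \<alpha>" for x
        using uf[of x] r \<alpha> by (intro powr_mono2; auto)+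
      have int: "integrable G (\<lambda>x. (1 - u * f x) powr \<alpha>)"
        using b(2) by (intro G.integrable_const_bound[of _ "2 powr \<alpha>"]) auto
      have "0 < (1 - r) powr \<alpha>" using r by simp
      also have "\<dots> = (LINT x|G. (1 - r) powr \<alpha>)" by (simp add: G.prob_space[simplified])
      also have "\<dots> \<le> (LINT x|G. (1 - u * f x) powr \<alpha>)"
        using int b(1) by (intro integral_mono) auto
      also have "\<dots> = eval_fps F u"
      proof -
        have "\<bar>u\<bar> < 1 / r" using u r1 by (simp add: le_less_trans)
        then show ?thesis using I[of u] by (simp add: eval_fps_def sums_iff)
      qed
      finally show ?thesis .
    qed
  qed
  then show ?thesis
    using H[of 1] I[of 1] r by (simp add: eval_fps_def sums_iff)
qed

text \<open>Both sides are homogeneous of degree -\<theta> in \<open>g\<close>. Scaling by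
  \<open>hi\<close> writes g = hi (1 - f) with f in [0, r], and \<open>X_one\<close> carries the
  constant 1 through the functional.\<close>

theorem markov_krein_bounded:
  assumes g [measurable]: "g \<in> borel_measurable borel" and lo: "0 < lo"
    and g_lo: "\<And>x. lo \<le> g x" and g_hi: "\<And>x. g x \<le> hi"
  shows "(LINT \<omega>|M. X g 0 \<omega> powr (- \<theta>)) = (LINT x|G. g x powr \<alpha>) powr (- \<theta> / \<alpha>)"
proof -
  define f where "f x = 1 - g x / hi" for x
  \<comment> \<open>The 2 keeps r > 0 even for lo = hi, that is, for constant
    \<open>g\<close>.\<close>
  define r where "r = 1 - lo / (2 * hi)"
  have hi: "0 < hi" "lo \<le> hi" using lo g_lo[of 0] g_hi[of 0] by auto
  have r: "0 < r" "r < 1" using hi lo by (auto simp: r_def field_simps)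
  have f: "0 \<le> f x" "f x \<le> r" for x
  proof -
    show "0 \<le> f x" using g_hi[of x] hi by (simp add: f_def)
    have "lo / (2 * hi) \<le> g x / hi" using g_lo[of x] hi lo by (simp add: field_simps)
    then show "f x \<le> r" by (simp add: f_def r_def)
  qed
  have [measurable]: "f \<in> borel_measurable borel" unfolding f_def[abs_def] by measurable
  have abs_f: "\<bar>f x\<bar> \<le> r" for x using f[of x] by simp
  have abs_g: "\<bar>g x\<bar> \<le> hi" for x using g_lo[of x] g_hi[of x] lo by auto
  have X_f: "X f 0 \<omega> = 1 * X (\<lambda>_. 1) 0 \<omega> + (- 1 / hi) * X g 0 \<omega>" for \<omega>
    using X_linear[of "\<lambda>_. 1" 1 g hi 1 "- 1 / hi" 0 \<omega>] abs_g by (simp add: f_def[abs_def])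
  from X_one have "AE \<omega> in M. X g 0 \<omega> = hi * (1 - X f 0 \<omega>)"
    by eventually_elim (use hi in \<open>simp add: X_f field_simps\<close>)
  then have "AE \<omega> in M. X g 0 \<omega> powr (- \<theta>) = hi powr (- \<theta>) * (1 - X f 0 \<omega>) powr (- \<theta>)"
  proof eventually_elim
    case (elim \<omega>)
    have "1 - X f 0 \<omega> \<ge> 0" using abs_X_le[of f r 0 \<omega>] abs_f r by auto
    then show ?case using elim hi by (simp add: powr_mult)
  qed
  then have "(LINT \<omega>|M. X g 0 \<omega> powr (- \<theta>)) = (LINT \<omega>|M. hi powr (- \<theta>) * (1 - X f 0 \<omega>) powr (- \<theta>))"
    by (intro integral_cong_AE) auto
  also have "\<dots> = hi powr (- \<theta>) * (LINT x|G. (1 - f x) powr \<alpha>) powr (- \<theta> / \<alpha>)"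
    using expectation_one_minus_X_powr[of f r] abs_f r by simp
  also have "hi powr (- \<theta>) = (hi powr \<alpha>) powr (- \<theta> / \<alpha>)"
    using \<alpha> by (simp add: powr_powr)
  also have "(hi powr \<alpha>) powr (- \<theta> / \<alpha>) * (LINT x|G. (1 - f x) powr \<alpha>) powr (- \<theta> / \<alpha>) =
      (hi powr \<alpha> * (LINT x|G. (1 - f x) powr \<alpha>)) powr (- \<theta> / \<alpha>)"
    by (simp add: powr_mult)
  also have "hi powr \<alpha> * (LINT x|G. (1 - f x) powr \<alpha>) = (LINT x|G. hi powr \<alpha> * (1 - f x) powr \<alpha>)" by simp
  also have "\<dots> = (LINT x|G. g x powr \<alpha>)"
  proof (intro Bochner_Integration.integral_cong refl)
    fix x
    have "hi powr \<alpha> * (1 - f x) powr \<alpha> = (hi * (1 - f x)) powr \<alpha>"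
      by (simp add: powr_mult)
    then show "hi powr \<alpha> * (1 - f x) powr \<alpha> = g x powr \<alpha>" using hi by (simp add: f_def)
  qed
  finally show ?thesis .
qed

end

subsection \<open>Joint transforms and truncation\<close>

text \<open>The reason for the range 1/2 in the expansion below: for \<bar>u\<bar> < 1/2 the ratio
  expanded in v has modulus at most 2, and \<bar>v\<bar> < 1/2 then keeps its product with v inside
  the unit disc.\<close>

lemma abs_divide_one_minus_mult_le:
  assumes "\<bar>x\<bar> \<le> (1::real)" "\<bar>y\<bar> \<le> 1" "\<bar>u\<bar> < 1 / 2"
  shows "\<bar>y / (1 - u * x)\<bar> \<le> 2"
proof -
  have "\<bar>u * x\<bar> \<le> 1 / 2" unfolding abs_mult using mult_mono[of "\<bar>u\<bar>" "1 / 2" "\<bar>x\<bar>" 1] assms by auto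
  then have "1 / 2 \<le> \<bar>1 - u * x\<bar>" by linarith
  then have "\<bar>y\<bar> / \<bar>1 - u * x\<bar> \<le> 1 / (1 / 2)" using assms by (intro frac_le) auto
  then show ?thesis by simp
qed

context stick_breaking
begin

context
  fixes \<phi> \<psi> :: "real \<Rightarrow> real"
  assumes \<phi> [measurable]: "\<phi> \<in> borel_measurable borel" and \<psi> [measurable]: "\<psi> \<in> borel_measurable borel"
    and \<phi>_le: "\<bar>\<phi> x\<bar> \<le> 1" and \<psi>_le: "\<bar>\<psi> x\<bar> \<le> 1"
begin

text \<open>On this diamond, which contains the square \<bar>u\<bar>, \<bar>v\<bar> < 1/2, the
  integrand 1 - u \<phi> - v \<psi> lies between 1 - (\<bar>u\<bar> + \<bar>v\<bar>) > 0 and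
  2.\<close>

lemma joint_transform:
  assumes uv: "\<bar>u\<bar> + \<bar>v\<bar> < 1"
  shows "(LINT \<omega>|M. (1 - u * X \<phi> 0 \<omega> - v * X \<psi> 0 \<omega>) powr (- \<theta>)) =
    (LINT x|G. (1 - u * \<phi> x - v * \<psi> x) powr \<alpha>) powr (- \<theta> / \<alpha>)"
proof -
  let ?h = "\<lambda>x. u * \<phi> x + v * \<psi> x"
  let ?g = "\<lambda>x. 1 * 1 + (- 1) * ?h x"
  have h: "\<bar>?h x\<bar> \<le> \<bar>u\<bar> + \<bar>v\<bar>" for x
  proof -
    have "\<bar>u * \<phi> x\<bar> \<le> \<bar>u\<bar> * 1" "\<bar>v * \<psi> x\<bar> \<le> \<bar>v\<bar> * 1"
      unfolding abs_mult using \<phi>_le \<psi>_le by (intro mult_left_mono; simp)+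
    then show ?thesis by linarith
  qed
  have g: "1 - (\<bar>u\<bar> + \<bar>v\<bar>) \<le> ?g x" "?g x \<le> 2" for x
  proof -
    have "?g x = 1 - ?h x" by simp
    then show "1 - (\<bar>u\<bar> + \<bar>v\<bar>) \<le> ?g x" "?g x \<le> 2"
      using h[of x] uv unfolding abs_le_iff by linarith+
  qed
  have "X ?g 0 \<omega> = 1 * X (\<lambda>_. 1) 0 \<omega> + (- 1) * (u * X \<phi> 0 \<omega> + v * X \<psi> 0 \<omega>)" for \<omega>
    using X_linear[of "\<lambda>_. 1" 1 ?h "\<bar>u\<bar> + \<bar>v\<bar>" 1 "- 1" 0 \<omega>] X_linear[of \<phi> 1 \<psi> 1 u v 0 \<omega>] h \<phi>_le \<psi>_le by simp
  with X_one have "AE \<omega> in M. X ?g 0 \<omega> = 1 - u * X \<phi> 0 \<omega> - v * X \<psi> 0 \<omega>"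
    by (auto elim!: eventually_mono)
  then have "(LINT \<omega>|M. (1 - u * X \<phi> 0 \<omega> - v * X \<psi> 0 \<omega>) powr (- \<theta>)) = (LINT \<omega>|M. X ?g 0 \<omega> powr (- \<theta>))"
    by (intro integral_cong_AE) (auto elim!: eventually_mono)
  also have "\<dots> = (LINT x|G. ?g x powr \<alpha>) powr (- \<theta> / \<alpha>)"
    using g uv by (intro markov_krein_bounded[of _ "1 - (\<bar>u\<bar> + \<bar>v\<bar>)" 2]) auto
  also have "?g = (\<lambda>x. 1 - u * \<phi> x - v * \<psi> x)" by auto
  finally show ?thesis .
qed

section \<open>Mixed moments by expansion in one variable after the other\<close>

abbreviation (input) tilted_moment :: "nat \<Rightarrow> real \<Rightarrow> real" where
  "tilted_moment m u \<equiv> (LINT \<omega>|M. X \<psi> 0 \<omega> ^ m * (1 - u * X \<phi> 0 \<omega>) powr (- (\<theta> + real m)))"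

text \<open>With A and B the functionals of \<phi> and \<psi>, factor 1 - u A - v B = (1 - u A) (1 -
  v B / (1 - u A)) and expand the second factor in v. Each power of v contributes one more factor 1
  - u A to the denominator, hence the exponent \<theta> + m in \<open>tilted_moment\<close>.\<close>

lemma transform_series_second:
  assumes u: "\<bar>u\<bar> < 1 / 2" and v: "\<bar>v\<bar> < 1 / 2"
  shows "(\<lambda>k. pochhammer \<theta> k / fact k * tilted_moment k u * v ^ k) sums
    ((LINT x|G. (1 - u * \<phi> x - v * \<psi> x) powr \<alpha>) powr (- \<theta> / \<alpha>))"
proof -
  let ?A = "\<lambda>\<omega>. (1 - u * X \<phi> 0 \<omega>) powr (- \<theta>)"
  let ?Y = "\<lambda>\<omega>. X \<psi> 0 \<omega> / (1 - u * X \<phi> 0 \<omega>)"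
  have X_le: "\<bar>X \<phi> 0 \<omega>\<bar> \<le> 1" "\<bar>X \<psi> 0 \<omega>\<bar> \<le> 1" for \<omega>
    using abs_X_le[of \<phi> 1] abs_X_le[of \<psi> 1] \<phi>_le \<psi>_le by auto
  have pos: "1 / 2 \<le> 1 - u * X \<phi> 0 \<omega>" for \<omega>
  proof -
    have "\<bar>u * X \<phi> 0 \<omega>\<bar> \<le> 1 / 2"
      unfolding abs_mult using mult_mono[of "\<bar>u\<bar>" "1 / 2" "\<bar>X \<phi> 0 \<omega>\<bar>" 1] u X_le by auto
    then show ?thesis by linarith
  qed
  have A: "\<bar>?A \<omega>\<bar> \<le> (1 / 2) powr (- \<theta>)" for \<omega>
    using pos[of \<omega>] \<theta> by (auto intro!: powr_mono2')
  have Y: "\<bar>?Y \<omega>\<bar> \<le> 2" for \<omega> using X_le u by (intro abs_divide_one_minus_mult_le)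
  have "(\<lambda>k. pochhammer \<theta> k / fact k * (LINT \<omega>|M. ?A \<omega> * ?Y \<omega> ^ k) * v ^ k) sums
      (LINT \<omega>|M. ?A \<omega> * (1 - v * ?Y \<omega>) powr (- \<theta>))"
    using A Y v by (intro expectation_binomial_sums[where R = 2]) auto
  moreover have "?A \<omega> * ?Y \<omega> ^ k = X \<psi> 0 \<omega> ^ k * (1 - u * X \<phi> 0 \<omega>) powr (- (\<theta> + real k))" for \<omega> k
    using pos[of \<omega>] by (simp add: powr_diff powr_realpow power_divide)
  moreover have "?A \<omega> * (1 - v * ?Y \<omega>) powr (- \<theta>) = (1 - u * X \<phi> 0 \<omega> - v * X \<psi> 0 \<omega>) powr (- \<theta>)" for \<omega>
  proof -
    have "?A \<omega> * (1 - v * ?Y \<omega>) powr (- \<theta>) = ((1 - u * X \<phi> 0 \<omega>) * (1 - v * ?Y \<omega>)) powr (- \<theta>)"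
      by (simp add: powr_mult)
    also have "(1 - u * X \<phi> 0 \<omega>) * (1 - v * ?Y \<omega>) = 1 - u * X \<phi> 0 \<omega> - v * X \<psi> 0 \<omega>"
      using pos[of \<omega>] by (simp add: field_simps)
    finally show ?thesis .
  qed
  ultimately show ?thesis using u v by (simp add: joint_transform)
qed

lemma tilted_moment_series:
  assumes "\<bar>u\<bar> < 1"
  shows "(\<lambda>k. pochhammer (\<theta> + real m) k / fact k * (LINT \<omega>|M. X \<psi> 0 \<omega> ^ m * X \<phi> 0 \<omega> ^ k) * u ^ k) sums tilted_moment m u"
proof -
  have "\<bar>X \<phi> 0 \<omega>\<bar> \<le> 1" "\<bar>X \<psi> 0 \<omega> ^ m\<bar> \<le> 1" for \<omega>
    using abs_X_le[of \<phi> 1] abs_X_le[of \<psi> 1] \<phi>_le \<psi>_le by (auto simp: power_abs intro!: power_le_one)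
  then show ?thesis using assms by (intro expectation_binomial_sums[where R = 1 and B = 1]) auto
qed

text \<open>The expansions follow the order of \<open>mixed_partial\<close>, first v and then u. The
  inner derivative is known only for \<bar>u\<bar> < 1/2, which suffices for derivatives at 0, and
  (\<theta>)_m (\<theta> + m)_n = (\<theta>)_(n+m) combines the constants.\<close>

lemma joint_moment_linear:
  "(LINT \<omega>|M. X \<phi> 0 \<omega> ^ n * X \<psi> 0 \<omega> ^ m) = 1 / pochhammer \<theta> (n + m) *
    mixed_partial n m (\<lambda>u v. (LINT x|G. (1 - u * \<phi> x - v * \<psi> x) powr \<alpha>) powr (- \<theta> / \<alpha>)) 0 0"
proof -
  let ?F = "\<lambda>u v. (LINT x|G. (1 - u * \<phi> x - v * \<psi> x) powr \<alpha>) powr (- \<theta> / \<alpha>)"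
  have inner: "(deriv ^^ m) (?F u) 0 = pochhammer \<theta> m * tilted_moment m u" if "\<bar>u\<bar> < 1 / 2" for u
    using higher_deriv_power_series_0[where f = "?F u" and r = "1 / 2", OF _ transform_series_second[OF that], of m]
    by simp
  have "(deriv ^^ n) (\<lambda>u. (deriv ^^ m) (?F u) 0) 0 =
     fact n * (pochhammer \<theta> m * (pochhammer (\<theta> + real m) n / fact n * (LINT \<omega>|M. X \<psi> 0 \<omega> ^ m * X \<phi> 0 \<omega> ^ n)))"
  proof (rule higher_deriv_power_series_0[where r = "1 / 2" and n = n and
        c = "\<lambda>k. pochhammer \<theta> m * (pochhammer (\<theta> + real m) k / fact k * (LINT \<omega>|M. X \<psi> 0 \<omega> ^ m * X \<phi> 0 \<omega> ^ k))"])
    show "(\<lambda>k. pochhammer \<theta> m * (pochhammer (\<theta> + real m) k / fact k * (LINT \<omega>|M. X \<psi> 0 \<omega> ^ m * X \<phi> 0 \<omega> ^ k)) * u ^ k) sums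
      (deriv ^^ m) (?F u) 0" if "\<bar>u\<bar> < 1 / 2" for u
      unfolding inner[OF that] using sums_mult[OF tilted_moment_series[of u m], of "pochhammer \<theta> m"] that by (simp add: mult_ac)
  qed simp
  moreover have "pochhammer \<theta> (n + m) = pochhammer \<theta> m * pochhammer (\<theta> + real m) n"
    using pochhammer_product'[of \<theta> m n] by (simp add: add.commute)
  moreover have "pochhammer \<theta> m \<noteq> 0" "pochhammer (\<theta> + real m) n \<noteq> 0"
    using \<theta> by (intro less_imp_neq[symmetric] pochhammer_pos; simp)+
  ultimately show ?thesis by (simp add: mixed_partial_def mult_ac)
qed

text \<open>Here v = z w, so m derivatives in w leave a factor z^m at w = 0. The moment with
  \<phi>-exponent n is thus the coefficient of z^(n+m): it takes n + m derivatives in z, which yield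
  (n + m)! where the series contributes only 1 / n!.\<close>

lemma joint_moment_product:
  "(LINT \<omega>|M. X \<phi> 0 \<omega> ^ n * X \<psi> 0 \<omega> ^ m) = fact n / fact (n + m) * (1 / pochhammer \<theta> (n + m)) *
    mixed_partial (n + m) m (\<lambda>z w. (LINT x|G. (1 - z * (\<phi> x + w * \<psi> x)) powr \<alpha>) powr (- \<theta> / \<alpha>)) 0 0"
proof -
  let ?F = "\<lambda>z w. (LINT x|G. (1 - z * (\<phi> x + w * \<psi> x)) powr \<alpha>) powr (- \<theta> / \<alpha>)"
  have inner: "(deriv ^^ m) (?F z) 0 = pochhammer \<theta> m * tilted_moment m z * z ^ m" if z: "\<bar>z\<bar> < 1 / 2" for z
  proof -
    have "(deriv ^^ m) (?F z) 0 = fact m * (pochhammer \<theta> m / fact m * tilted_moment m z * z ^ m)"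
    proof (rule higher_deriv_power_series_0[where r = 1 and n = m and c = "\<lambda>k. pochhammer \<theta> k / fact k * tilted_moment k z * z ^ k"])
      fix w :: real assume w: "\<bar>w\<bar> < 1"
      have "\<bar>z * w\<bar> \<le> \<bar>z\<bar> * 1" unfolding abs_mult using w by (intro mult_left_mono) auto
      then have "\<bar>z * w\<bar> < 1 / 2" using z by linarith
      from transform_series_second[OF z this]
      show "(\<lambda>k. pochhammer \<theta> k / fact k * tilted_moment k z * z ^ k * w ^ k) sums ?F z w"
        by (simp add: power_mult_distrib algebra_simps)
    qed simp
    then show ?thesis by simp
  qed
  define c where "c k = pochhammer \<theta> m * (pochhammer (\<theta> + real m) k / fact k * (LINT \<omega>|M. X \<psi> 0 \<omega> ^ m * X \<phi> 0 \<omega> ^ k))" for k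
  have "(deriv ^^ (n + m)) (\<lambda>z. (deriv ^^ m) (?F z) 0) 0 = fact (n + m) * (if n + m < m then 0 else c (n + m - m))"
  proof (rule higher_deriv_power_series_0[where r = "1 / 2" and n = "n + m" and c = "\<lambda>k. if k < m then 0 else c (k - m)"])
    fix z :: real assume z: "\<bar>z\<bar> < 1 / 2"
    have "(\<lambda>k. c k * z ^ (k + m)) sums (pochhammer \<theta> m * tilted_moment m z * z ^ m)"
      using sums_mult[OF tilted_moment_series[of z m], of "pochhammer \<theta> m * z ^ m"] z by (simp add: c_def power_add mult_ac)
    then show "(\<lambda>k. (if k < m then 0 else c (k - m)) * z ^ k) sums (deriv ^^ m) (?F z) 0"
      unfolding inner[OF z] by (subst sums_zero_iff_shift[symmetric, of m]) auto
  qed simp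
  moreover have "pochhammer \<theta> (n + m) = pochhammer \<theta> m * pochhammer (\<theta> + real m) n"
    using pochhammer_product'[of \<theta> m n] by (simp add: add.commute)
  moreover have "pochhammer \<theta> m \<noteq> 0" "pochhammer (\<theta> + real m) n \<noteq> 0"
    using \<theta> by (intro less_imp_neq[symmetric] pochhammer_pos; simp)+
  ultimately show ?thesis by (simp add: mixed_partial_def c_def mult_ac)
qed

end

section \<open>Non-negative integrands by truncation\<close>

lemma integrable_powr_of_le:
  assumes [measurable]: "h \<in> borel_measurable borel" and h: "\<And>x. 0 \<le> h x" "\<And>x. h x \<le> k x"
    and k: "integrable G (\<lambda>x. k x powr \<alpha>)"
  shows "integrable G (\<lambda>x. h x powr \<alpha>)"
  using k
proof (rule Bochner_Integration.integrable_bound)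
  show "AE x in G. norm (h x powr \<alpha>) \<le> norm (k x powr \<alpha>)"
    using h \<alpha> by (intro AE_I2) (auto intro!: powr_mono2)
qed measurable

context
  fixes h :: "real \<Rightarrow> real" and S :: "'a \<Rightarrow> ennreal"
  assumes h [measurable]: "h \<in> borel_measurable borel" and h_nonneg: "0 \<le> h x"
    and h_int: "integrable G (\<lambda>x. (1 + h x) powr \<alpha>)"
    and S [measurable]: "S \<in> borel_measurable M"
    and S_lim: "(\<lambda>N. ennreal (X (\<lambda>x. min (h x) (real N)) 0 \<omega>)) \<longlonglongrightarrow> S \<omega>"
begin

text \<open>Each truncation is bounded, and dominated convergence is applied on both sides. Where
  \<open>S\<close> is infinite the negative power tends to 0, hence the value 0 there. The scale c
  is kept for the finiteness argument; c \<le> 1 lets integrability of (1 + c h)^\<alpha> follow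
  from that of (1 + h)^\<alpha>.\<close>

lemma truncation_limit:
  assumes c: "0 < c" "c \<le> 1"
  shows "(LINT \<omega>|M. (if S \<omega> = top then 0 else (1 + c * enn2real (S \<omega>)) powr (- \<theta>))) =
    (LINT x|G. (1 + c * h x) powr \<alpha>) powr (- \<theta> / \<alpha>)"
proof -
  define H where "H N x = min (h x) (real N)" for N x
  have [measurable]: "H N \<in> borel_measurable borel" for N unfolding H_def[abs_def] by measurable
  have H: "0 \<le> H N x" "H N x \<le> real N" "H N x \<le> h x" for N x using h_nonneg by (auto simp: H_def)
  have XH_nonneg: "0 \<le> X (H N) 0 \<omega>" for N \<omega>
    unfolding X_def stick_sum_def
    by (intro suminf_nonneg summable_stick_sum[where B = "real N"] mult_nonneg_nonneg stick_weight_nonneg V_range)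
      (use H in auto)
  have eq: "(LINT \<omega>|M. (1 + c * X (H N) 0 \<omega>) powr (- \<theta>)) = (LINT x|G. (1 + c * H N x) powr \<alpha>) powr (- \<theta> / \<alpha>)" for N
  proof -
    let ?g = "\<lambda>x. 1 * 1 + c * H N x"
    have "X ?g 0 \<omega> = 1 * X (\<lambda>_. 1) 0 \<omega> + c * X (H N) 0 \<omega>" for \<omega>
      using X_linear[of "\<lambda>_. 1" 1 "H N" "real N" 1 c 0 \<omega>] H by simp
    with X_one have "AE \<omega> in M. X ?g 0 \<omega> = 1 + c * X (H N) 0 \<omega>"
      by (auto elim!: eventually_mono)
    then have "(LINT \<omega>|M. (1 + c * X (H N) 0 \<omega>) powr (- \<theta>)) = (LINT \<omega>|M. X ?g 0 \<omega> powr (- \<theta>))"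
      by (intro integral_cong_AE) (auto elim!: eventually_mono)
    also have "\<dots> = (LINT x|G. ?g x powr \<alpha>) powr (- \<theta> / \<alpha>)"
      using H c by (intro markov_krein_bounded[of _ 1 "1 + c * real N"]) (auto intro!: mult_left_mono)
    finally show ?thesis by simp
  qed
  have ch: "c * h x \<le> h x" "0 \<le> c * h x" "0 \<le> c * H N x" "c * H N x \<le> c * h x" for N x
    using mult_right_mono[of c 1 "h x"] c h_nonneg[of x] H[of N x] by (auto intro: mult_left_mono)
  have dom: "integrable G (\<lambda>x. (1 + c * h x) powr \<alpha>)"
    using ch by (intro integrable_powr_of_le[OF _ _ _ h_int]) (auto intro: add_nonneg_nonneg)
  have "(\<lambda>N. LINT x|G. (1 + c * H N x) powr \<alpha>) \<longlonglongrightarrow> (LINT x|G. (1 + c * h x) powr \<alpha>)"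
  proof (rule integral_dominated_convergence[OF _ _ dom])
    show "AE x in G. (\<lambda>N. (1 + c * H N x) powr \<alpha>) \<longlonglongrightarrow> (1 + c * h x) powr \<alpha>"
    proof (rule AE_I2)
      fix x
      obtain n where "h x \<le> real n" using real_arch_simple by blast
      then have "\<forall>\<^sub>F N in sequentially. (1 + c * H N x) powr \<alpha> = (1 + c * h x) powr \<alpha>"
        by (intro eventually_sequentiallyI[of n]) (auto simp: H_def min_def)
      then show "(\<lambda>N. (1 + c * H N x) powr \<alpha>) \<longlonglongrightarrow> (1 + c * h x) powr \<alpha>" by (rule tendsto_eventually)
    qed
    show "AE x in G. norm ((1 + c * H N x) powr \<alpha>) \<le> (1 + c * h x) powr \<alpha>" for N
      using ch \<alpha> by (intro AE_I2) (auto intro!: powr_mono2)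
  qed measurable
  \<comment> \<open>The limit stays away from 0, where a negative power would fail to be
    continuous.\<close>
  moreover have "1 \<le> (LINT x|G. (1 + c * h x) powr \<alpha>)"
  proof -
    have "(LINT x|G. 1) \<le> (LINT x|G. (1 + c * h x) powr \<alpha>)"
      using dom ch \<alpha> by (intro integral_mono) (auto intro!: ge_one_powr_ge_zero)
    then show ?thesis by (simp add: G.prob_space[simplified])
  qed
  ultimately have "(\<lambda>N. (LINT x|G. (1 + c * H N x) powr \<alpha>) powr (- \<theta> / \<alpha>)) \<longlonglongrightarrow>
      (LINT x|G. (1 + c * h x) powr \<alpha>) powr (- \<theta> / \<alpha>)"
    by (intro tendsto_powr tendsto_const) auto
  moreover have "(\<lambda>N. (LINT \<omega>|M. (1 + c * X (H N) 0 \<omega>) powr (- \<theta>))) \<longlonglongrightarrow>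
    (LINT \<omega>|M. (if S \<omega> = top then 0 else (1 + c * enn2real (S \<omega>)) powr (- \<theta>)))"
  proof (rule integral_dominated_convergence[where w = "\<lambda>_. 1"])
    show "AE \<omega> in M. (\<lambda>N. (1 + c * X (H N) 0 \<omega>) powr (- \<theta>)) \<longlonglongrightarrow>
       (if S \<omega> = top then 0 else (1 + c * enn2real (S \<omega>)) powr (- \<theta>))"
    proof (rule AE_I2)
      fix \<omega>
      have lim: "(\<lambda>N. ennreal (X (H N) 0 \<omega>)) \<longlonglongrightarrow> S \<omega>" using S_lim[of \<omega>] by (simp add: H_def[abs_def])
      show "(\<lambda>N. (1 + c * X (H N) 0 \<omega>) powr (- \<theta>)) \<longlonglongrightarrow>
         (if S \<omega> = top then 0 else (1 + c * enn2real (S \<omega>)) powr (- \<theta>))"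
      proof (cases "S \<omega> = top")
        case True
        then have "filterlim (\<lambda>N. X (H N) 0 \<omega>) at_top sequentially"
          using lim by (simp add: ennreal_tendsto_top_eq_at_top)
        then have "filterlim (\<lambda>N. 1 + c * X (H N) 0 \<omega>) at_top sequentially"
          using c by (intro filterlim_tendsto_add_at_top[OF tendsto_const] filterlim_tendsto_pos_mult_at_top[OF tendsto_const])
        then show ?thesis using \<theta> True by (auto intro!: tendsto_neg_powr)
      next
        case False
        then obtain s where s: "0 \<le> s" "S \<omega> = ennreal s" by (cases "S \<omega>") auto
        then have "(\<lambda>N. X (H N) 0 \<omega>) \<longlonglongrightarrow> s"
          using lim XH_nonneg by (simp add: tendsto_ennreal_iff)
        then show ?thesis using s c
          by (auto intro!: tendsto_intros simp: add_nonneg_eq_0_iff)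
      qed
    qed
    show "AE \<omega> in M. norm ((1 + c * X (H N) 0 \<omega>) powr (- \<theta>)) \<le> 1" for N
      using XH_nonneg[of N] c \<theta> by (intro AE_I2) (auto intro!: powr_le_one_le simp: powr_minus divide_simps ge_one_powr_ge_zero)
  qed measurable
  ultimately show ?thesis
    unfolding eq using LIMSEQ_unique by blast
qed

text \<open>As c tends to 0 in \<open>truncation_limit\<close>, the left side tends to the
  probability that \<open>S\<close> is finite, the right side to 1.\<close>

lemma AE_limit_finite: "AE \<omega> in M. S \<omega> \<noteq> top"
proof -
  define c where "c K = 1 / (real K + 1)" for K
  have c: "0 < c K" "c K \<le> 1" for K by (auto simp: c_def)
  have c_lim: "c \<longlonglongrightarrow> 0" unfolding c_def using LIMSEQ_Suc[OF lim_1_over_n[where 'a = real]] by (simp add: add.commute)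
  have "(\<lambda>K. LINT x|G. (1 + c K * h x) powr \<alpha>) \<longlonglongrightarrow> (LINT x|G. (1 + 0 * h x) powr \<alpha>)"
  proof (rule integral_dominated_convergence[OF _ _ h_int])
    show "AE x in G. (\<lambda>K. (1 + c K * h x) powr \<alpha>) \<longlonglongrightarrow> (1 + 0 * h x) powr \<alpha>"
      using c_lim by (intro AE_I2 tendsto_intros) auto
    show "AE x in G. norm ((1 + c K * h x) powr \<alpha>) \<le> (1 + h x) powr \<alpha>" for K
    proof (rule AE_I2)
      fix x
      have "c K * h x \<le> 1 * h x" "0 \<le> c K * h x"
        using mult_right_mono[of "c K" 1 "h x"] c[of K] h_nonneg[of x] by auto
      then show "norm ((1 + c K * h x) powr \<alpha>) \<le> (1 + h x) powr \<alpha>" using \<alpha> by (auto intro!: powr_mono2)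
    qed
  qed measurable
  then have "(\<lambda>K. (LINT x|G. (1 + c K * h x) powr \<alpha>) powr (- \<theta> / \<alpha>)) \<longlonglongrightarrow> 1 powr (- \<theta> / \<alpha>)"
    by (intro tendsto_powr tendsto_const) (auto simp: G.prob_space[simplified])
  moreover have "(\<lambda>K. LINT \<omega>|M. (if S \<omega> = top then 0 else (1 + c K * enn2real (S \<omega>)) powr (- \<theta>))) \<longlonglongrightarrow>
     (LINT \<omega>|M. (if S \<omega> = top then 0 else (1 + 0 * enn2real (S \<omega>)) powr (- \<theta>)))"
  proof (rule integral_dominated_convergence[where w = "\<lambda>_. 1"])
    show "AE \<omega> in M. (\<lambda>K. (if S \<omega> = top then 0 else (1 + c K * enn2real (S \<omega>)) powr (- \<theta>))) \<longlonglongrightarrow>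
     (if S \<omega> = top then 0 else (1 + 0 * enn2real (S \<omega>)) powr (- \<theta>))"
      using c_lim by (intro AE_I2) (auto intro!: tendsto_eq_intros)
    show "AE \<omega> in M. norm (if S \<omega> = top then 0 else (1 + c K * enn2real (S \<omega>)) powr (- \<theta>)) \<le> 1" for K
      using c[of K] \<theta> by (intro AE_I2) (auto simp: powr_minus divide_simps ge_one_powr_ge_zero)
  qed measurable
  ultimately have "(LINT \<omega>|M. (if S \<omega> = top then 0 else (1 + 0 * enn2real (S \<omega>)) powr (- \<theta>))) = 1"
    unfolding truncation_limit[OF c] using LIMSEQ_unique by fastforce
  moreover have "(if S \<omega> = top then 0 else (1 + 0 * enn2real (S \<omega>)) powr (- \<theta>)) = indicator {\<omega>. S \<omega> \<noteq> top} \<omega>" for \<omega>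
    by (auto simp: indicator_def)
  ultimately have "(LINT \<omega>|M. indicator {\<omega>. S \<omega> \<noteq> top} \<omega>) = (1 :: real)" by simp
  then have "prob {\<omega> \<in> space M. S \<omega> \<noteq> top} = 1" 
    by (simp add: Bochner_Integration.integral_indicator Int_def conj_commute)
  then show ?thesis by (subst (asm) prob_Collect_eq_1) auto
qed

end

end

subsection \<open>The Pitman--Yor process\<close>

text \<open>As the image of a weighted counting measure under the atoms, the random measure inherits
  its integrals from series over the index.\<close>

lemma weighted_diracs_eq_distr:
  "weighted_diracs w x = distr (density (count_space UNIV) (\<lambda>n. ennreal (w n))) borel x"
proof (rule measure_eqI)
  fix A assume "A \<in> sets (weighted_diracs w x)"
  then have [measurable]: "A \<in> sets borel" by simp
  have "emeasure (distr (density (count_space UNIV) (\<lambda>n. ennreal (w n))) borel x) A =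
      (\<integral>\<^sup>+ n. ennreal (w n) * indicator (x -` A) n \<partial>count_space UNIV)"
    by (simp add: emeasure_distr emeasure_density)
  also have "\<dots> = (\<Sum>n. ennreal (w n) * emeasure (return borel (x n)) A)"
    by (simp add: nn_integral_count_space_nat indicator_vimage)
  finally show "emeasure (weighted_diracs w x) A =
      emeasure (distr (density (count_space UNIV) (\<lambda>n. ennreal (w n))) borel x) A"
    by (simp add: emeasure_weighted_diracs)
qed simp

lemma nn_integral_weighted_diracs:
  assumes [measurable]: "f \<in> borel_measurable borel"
  shows "(\<integral>\<^sup>+ y. f y \<partial>weighted_diracs w x) = (\<Sum>n. ennreal (w n) * f (x n))"
  by (simp add: weighted_diracs_eq_distr nn_integral_distr nn_integral_density nn_integral_count_space_nat)

lemma integral_weighted_diracs: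
  fixes f :: "real \<Rightarrow> real"
  assumes [measurable]: "f \<in> borel_measurable borel" and w: "\<And>n. 0 \<le> w n"
    and s: "summable (\<lambda>n. \<bar>w n * f (x n)\<bar>)"
  shows "(LINT y|weighted_diracs w x. f y) = (\<Sum>n. w n * f (x n))"
proof -
  have "(LINT y|weighted_diracs w x. f y) = (LINT n|count_space UNIV. w n *\<^sub>R f (x n))"
    using w by (simp add: weighted_diracs_eq_distr integral_distr integral_density)
  also have "\<dots> = (\<Sum>n. w n * f (x n))"
    using s by (subst integral_count_space_nat) (auto simp: integrable_count_space_nat_iff)
  finally show ?thesis .
qed

lemma measurable_integral_weighted_diracs:
  fixes f :: "real \<Rightarrow> real"
  assumes [measurable]: "f \<in> borel_measurable borel"
    "\<And>n. (\<lambda>\<omega>. w \<omega> n) \<in> borel_measurable M" "\<And>n. (\<lambda>\<omega>. x \<omega> n) \<in> borel_measurable M"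
  shows "(\<lambda>\<omega>. LINT y|weighted_diracs (w \<omega>) (x \<omega>). f y) \<in> borel_measurable M"
proof -
  let ?N = "\<lambda>g \<omega>. (\<Sum>n. ennreal (w \<omega> n) * ennreal (g (x \<omega> n)))"
  \<comment> \<open>The integral is 0 by convention where \<open>f\<close> is not integrable, whence
    the case split. As \<open>ennreal\<close> sends negative reals to 0, \<open>?N f\<close> and
    \<open>?N (\<lambda>y. - f y)\<close> are the integrals of the positive and negative parts, and
    all are countable sums of measurable terms.\<close>
  have "(LINT y|weighted_diracs (w \<omega>) (x \<omega>). f y) =
      (if ?N (\<lambda>y. \<bar>f y\<bar>) \<omega> < \<infinity> then enn2real (?N f \<omega>) - enn2real (?N (\<lambda>y. - f y) \<omega>) else 0)" for \<omega>
  proof -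
    have "integrable (weighted_diracs (w \<omega>) (x \<omega>)) f \<longleftrightarrow> ?N (\<lambda>y. \<bar>f y\<bar>) \<omega> < \<infinity>"
      by (simp add: integrable_iff_bounded nn_integral_weighted_diracs)
    then show ?thesis
      by (auto simp: real_lebesgue_integral_def nn_integral_weighted_diracs not_integrable_integral_eq)
  qed
  then show ?thesis by simp
qed

context stick_breaking
begin

lemma integral_weighted_diracs_eq_X:
  assumes "f \<in> borel_measurable borel" "\<And>x. \<bar>f x\<bar> \<le> B"
  shows "(LINT x|weighted_diracs (stick_weight (\<lambda>n. V n \<omega>)) (\<lambda>n. \<xi> n \<omega>). f x) = X f 0 \<omega>"
proof -
  have w: "0 \<le> stick_weight (\<lambda>n. V n \<omega>) n" for n by (rule stick_weight_nonneg) (rule V_range)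
  have "summable (\<lambda>n. stick_weight (\<lambda>n. V n \<omega>) n * \<bar>f (\<xi> n \<omega>)\<bar>)"
    using assms by (intro summable_stick_sum[where f = "\<lambda>x. \<bar>f x\<bar>" and B = B] V_range) auto
  then show ?thesis
    using w by (subst integral_weighted_diracs) (auto simp: assms abs_mult X_def stick_sum_def)
qed

lemma truncation_tendsto:
  assumes [measurable]: "h \<in> borel_measurable borel" and h: "\<And>x. 0 \<le> h x"
  shows "(\<lambda>N. ennreal (X (\<lambda>x. min (h x) (real N)) 0 \<omega>)) \<longlonglongrightarrow>
    (\<integral>\<^sup>+ x. ennreal (h x) \<partial>weighted_diracs (stick_weight (\<lambda>n. V n \<omega>)) (\<lambda>n. \<xi> n \<omega>))"
proof -
  let ?P = "weighted_diracs (stick_weight (\<lambda>n. V n \<omega>)) (\<lambda>n. \<xi> n \<omega>)"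
  have w: "0 \<le> stick_weight (\<lambda>n. V n \<omega>) n" for n by (rule stick_weight_nonneg) (rule V_range)
  have "(\<lambda>N. \<integral>\<^sup>+ x. ennreal (min (h x) (real N)) \<partial>?P) \<longlonglongrightarrow> (\<integral>\<^sup>+ x. ennreal (h x) \<partial>?P)"
  proof (rule nn_integral_LIMSEQ)
    show "incseq (\<lambda>N x. ennreal (min (h x) (real N)))"
      by (auto simp: incseq_def le_fun_def intro!: ennreal_leI)
    fix x
    obtain n where "h x \<le> real n" using real_arch_simple by blast
    then have "\<forall>\<^sub>F N in sequentially. ennreal (min (h x) (real N)) = ennreal (h x)"
      by (intro eventually_sequentiallyI[of n]) (auto simp: min_def)
    then show "(\<lambda>N. ennreal (min (h x) (real N))) \<longlonglongrightarrow> ennreal (h x)" by (rule tendsto_eventually)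
  qed measurable
  moreover have "(\<integral>\<^sup>+ x. ennreal (min (h x) (real N)) \<partial>?P) = ennreal (X (\<lambda>x. min (h x) (real N)) 0 \<omega>)" for N
  proof -
    have "(\<integral>\<^sup>+ x. ennreal (min (h x) (real N)) \<partial>?P) =
        (\<Sum>n. ennreal (stick_weight (\<lambda>n. V n \<omega>) n * min (h (\<xi> n \<omega>)) (real N)))"
      using h w by (subst nn_integral_weighted_diracs) (auto simp: ennreal_mult)
    also have "\<dots> = ennreal (X (\<lambda>x. min (h x) (real N)) 0 \<omega>)"
      unfolding X_def stick_sum_def add_0
      using h w by (intro suminf_ennreal2 summable_stick_sum[where B = "real N"] V_range) auto
    finally show ?thesis .
  qed
  ultimately show ?thesis by simp
qed

end

lemma powr_add_le:
  assumes "0 \<le> (x::real)" "0 \<le> y" "0 \<le> a"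
  shows "(x + y) powr a \<le> 2 powr a * (x powr a + y powr a)"
proof -
  have "(x + y) powr a \<le> (2 * max x y) powr a" using assms by (intro powr_mono2) auto
  also have "\<dots> = 2 powr a * max x y powr a" by (simp add: powr_mult)
  also have "\<dots> \<le> 2 powr a * (x powr a + y powr a)" by (intro mult_left_mono) (auto simp: max_def)
  finally show ?thesis .
qed

text \<open>Absorbing s and t into h = s \<phi> + t \<psi> reduces the claim to
  \<open>truncation_limit\<close> at c = 1. Finiteness of the functional of h outside a null set
  allows it to be split into those of \<phi> and \<psi>.\<close>

lemma (in stick_breaking) stieltjes_unbounded:
  fixes \<phi> \<psi> :: "real \<Rightarrow> real"
  assumes [measurable]: "\<phi> \<in> borel_measurable borel" "\<psi> \<in> borel_measurable borel"
    and nonneg: "\<And>x. 0 \<le> \<phi> x" "\<And>x. 0 \<le> \<psi> x"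
    and int: "integrable G (\<lambda>x. \<phi> x powr \<alpha> + \<psi> x powr \<alpha>)" and st: "0 < s" "0 < t"
  defines "P \<equiv> \<lambda>\<omega>. weighted_diracs (stick_weight (\<lambda>n. V n \<omega>)) (\<lambda>n. \<xi> n \<omega>)"
  shows "(LINT \<omega>|M. (1 + s * (LINT x|P \<omega>. \<phi> x) + t * (LINT x|P \<omega>. \<psi> x)) powr (- \<theta>)) =
    (LINT x|G. (1 + s * \<phi> x + t * \<psi> x) powr \<alpha>) powr (- \<theta> / \<alpha>)"
proof -
  define h where "h x = s * \<phi> x + t * \<psi> x" for x
  have h [measurable]: "h \<in> borel_measurable borel" unfolding h_def[abs_def] by measurable
  have h_nonneg: "0 \<le> h x" for x using nonneg st by (simp add: h_def)
  define S where "S \<omega> = (\<integral>\<^sup>+ x. ennreal (h x) \<partial>P \<omega>)" for \<omega>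
  have [measurable]: "(\<lambda>\<omega>. stick_weight (\<lambda>n. V n \<omega>) n) \<in> borel_measurable M" for n
    unfolding stick_weight_def by measurable
  have S_meas: "S \<in> borel_measurable M"
    unfolding S_def[abs_def] P_def nn_integral_weighted_diracs[OF measurable_compose[OF h measurable_ennreal]] by measurable
  have h_int: "integrable G (\<lambda>x. (1 + h x) powr \<alpha>)"
  proof (rule Bochner_Integration.integrable_bound)
    \<comment> \<open>Two uses of \<open>powr_add_le\<close>, one for 1 + h and one for s \<phi> + t
      \<psi>, give this constant.\<close>
    define C where "C = 2 powr \<alpha> * (2 powr \<alpha> * (s powr \<alpha> + t powr \<alpha>))"
    show "integrable G (\<lambda>x. 2 powr \<alpha> + C * (\<phi> x powr \<alpha> + \<psi> x powr \<alpha>))"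
      using int by simp
    show "AE x in G. norm ((1 + h x) powr \<alpha>) \<le> norm (2 powr \<alpha> + C * (\<phi> x powr \<alpha> + \<psi> x powr \<alpha>))"
    proof (rule AE_I2)
      fix x
      have "h x powr \<alpha> \<le> 2 powr \<alpha> * ((s * \<phi> x) powr \<alpha> + (t * \<psi> x) powr \<alpha>)"
        unfolding h_def using nonneg st \<alpha> by (intro powr_add_le) auto
      also have "(s * \<phi> x) powr \<alpha> + (t * \<psi> x) powr \<alpha> \<le> (s powr \<alpha> + t powr \<alpha>) * (\<phi> x powr \<alpha> + \<psi> x powr \<alpha>)"
        by (simp add: powr_mult algebra_simps)
      finally have "h x powr \<alpha> \<le> 2 powr \<alpha> * ((s powr \<alpha> + t powr \<alpha>) * (\<phi> x powr \<alpha> + \<psi> x powr \<alpha>))" by simp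
      moreover have "(1 + h x) powr \<alpha> \<le> 2 powr \<alpha> * (1 powr \<alpha> + h x powr \<alpha>)"
        using h_nonneg \<alpha> by (intro powr_add_le) auto
      ultimately have "(1 + h x) powr \<alpha> \<le> 2 powr \<alpha> * (1 + 2 powr \<alpha> * ((s powr \<alpha> + t powr \<alpha>) * (\<phi> x powr \<alpha> + \<psi> x powr \<alpha>)))"
        by (simp add: order_trans[OF _ mult_left_mono])
      also have "\<dots> = 2 powr \<alpha> + C * (\<phi> x powr \<alpha> + \<psi> x powr \<alpha>)" by (simp add: C_def algebra_simps)
      finally show "norm ((1 + h x) powr \<alpha>) \<le> norm (2 powr \<alpha> + C * (\<phi> x powr \<alpha> + \<psi> x powr \<alpha>))" by simp
    qed
  qed measurable
  have S_lim: "(\<lambda>N. ennreal (X (\<lambda>x. min (h x) (real N)) 0 \<omega>)) \<longlonglongrightarrow> S \<omega>" for \<omega>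
    unfolding S_def P_def by (rule truncation_tendsto[OF h h_nonneg])
  have "AE \<omega> in M. S \<omega> \<noteq> top" by (rule AE_limit_finite[OF h h_nonneg h_int S_meas S_lim])
  then have "AE \<omega> in M. (1 + s * (LINT x|P \<omega>. \<phi> x) + t * (LINT x|P \<omega>. \<psi> x)) powr (- \<theta>) =
      (if S \<omega> = top then 0 else (1 + 1 * enn2real (S \<omega>)) powr (- \<theta>))"
  proof eventually_elim
    case (elim \<omega>)
    have sets_P [measurable_cong]: "sets (P \<omega>) = sets borel" by (simp add: P_def)
    have int_h: "integrable (P \<omega>) h"
      using elim h_nonneg by (intro integrableI_nonneg) (auto simp: S_def top.not_eq_extremum)
    \<comment> \<open>Both summands are nonnegative and at most h, so each is integrable once
      \<open>S\<close> is finite.\<close>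
    have "integrable (P \<omega>) (\<lambda>x. s * \<phi> x)" "integrable (P \<omega>) (\<lambda>x. t * \<psi> x)"
      by (rule Bochner_Integration.integrable_bound[OF int_h], measurable,
        use nonneg st in \<open>simp add: h_def abs_mult\<close>)+
    then have "(LINT x|P \<omega>. h x) = s * (LINT x|P \<omega>. \<phi> x) + t * (LINT x|P \<omega>. \<psi> x)"
      unfolding h_def by simp
    moreover have "(LINT x|P \<omega>. h x) = enn2real (S \<omega>)"
      unfolding S_def using h_nonneg by (intro integral_eq_nn_integral) auto
    ultimately show ?case using elim by (simp add: add.assoc)
  qed
  then have "(LINT \<omega>|M. (1 + s * (LINT x|P \<omega>. \<phi> x) + t * (LINT x|P \<omega>. \<psi> x)) powr (- \<theta>)) =
      (LINT \<omega>|M. (if S \<omega> = top then 0 else (1 + 1 * enn2real (S \<omega>)) powr (- \<theta>)))"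
  proof (rule integral_cong_AE[rotated 2])
    have [measurable]: "(\<lambda>\<omega>. LINT x|P \<omega>. f x) \<in> borel_measurable M" if "f \<in> borel_measurable borel" for f :: "real \<Rightarrow> real"
      unfolding P_def by (rule measurable_integral_weighted_diracs) (use that in measurable)
    show "(\<lambda>\<omega>. (1 + s * (LINT x|P \<omega>. \<phi> x) + t * (LINT x|P \<omega>. \<psi> x)) powr (- \<theta>)) \<in> borel_measurable M"
      by measurable
  qed (use S_meas in measurable)
  also have "\<dots> = (LINT x|G. (1 + 1 * h x) powr \<alpha>) powr (- \<theta> / \<alpha>)"
    by (rule truncation_limit[OF h h_nonneg h_int S_meas S_lim]) auto
  finally show ?thesis by (simp add: h_def add.assoc)
qed

text \<open>The sticks lie in \<open>[0, 1]\<close> only almost surely, so they are clamped to this interval.\<close>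

lemma pitman_yor_process_stick_breaking:
  assumes "0 < \<alpha>" "0 < \<theta>" and py: "pitman_yor_process M \<alpha> \<theta> G p"
  obtains V \<xi> where "stick_breaking M \<alpha> \<theta> G V \<xi>"
    "AE \<omega> in M. p \<omega> = weighted_diracs (stick_weight (\<lambda>n. V n \<omega>)) (\<lambda>n. \<xi> n \<omega>)"
    "\<And>f :: real \<Rightarrow> real. f \<in> borel_measurable borel \<Longrightarrow> (\<lambda>\<omega>. LINT x|p \<omega>. f x) \<in> borel_measurable M"
proof -
  from py obtain V \<xi> where "prob_space M" and \<alpha>1: "\<alpha> < 1"
    and V: "prob_space.indep_vars M (\<lambda>_. borel) V UNIV"
    and VD: "\<And>n. distributed M lborel (V n) (beta_density (1 - \<alpha>) (\<theta> + real (n + 1) * \<alpha>))"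
    and \<xi>: "prob_space.indep_vars M (\<lambda>_. borel) \<xi> UNIV" and \<xi>D: "\<And>n. distr M borel (\<xi> n) = G"
    and ind: "prob_space.indep_var M
          (\<Pi>\<^sub>M n\<in>UNIV. borel) (\<lambda>\<omega> n. V n \<omega>) (\<Pi>\<^sub>M n\<in>UNIV. borel) (\<lambda>\<omega> n. \<xi> n \<omega>)"
    and p: "\<And>\<omega>. \<omega> \<in> space M \<Longrightarrow> p \<omega> = weighted_diracs (stick_weight (\<lambda>n. V n \<omega>)) (\<lambda>n. \<xi> n \<omega>)"
    unfolding pitman_yor_process_def by auto
  interpret prob_space M by fact
  have [measurable]: "V n \<in> borel_measurable M" "\<xi> n \<in> borel_measurable M" for n
    using V \<xi> by (auto simp: indep_vars_def)
  define r where "r x = max 0 (min 1 x)" for x :: real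
  have [measurable]: "r \<in> borel_measurable borel" unfolding r_def[abs_def] by measurable
  define W where "W n \<omega> = r (V n \<omega>)" for n \<omega>
  have [measurable]: "W n \<in> borel_measurable M" for n unfolding W_def[abs_def] by measurable
  have V01: "AE \<omega> in M. W n \<omega> = V n \<omega>" for n
  proof -
    let ?d = "beta_density (1 - \<alpha>) (\<theta> + real (n + 1) * \<alpha>)"
    \<comment> \<open>The beta density vanishes outside (0, 1), and \<open>r\<close> is the identity
      on [0, 1].\<close>
    have "AE x in distr M lborel (V n). r x = x"
      unfolding distributed_distr_eq_density[OF VD]
      using distributed_borel_measurable[OF VD[of n]]
      by (subst AE_density) (auto intro!: AE_I2 simp: beta_density_def r_def split: if_splits)
    then show ?thesis by (subst (asm) AE_distr_iff) (auto simp: W_def)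
  qed
  have "stick_breaking M \<alpha> \<theta> G W \<xi>"
  proof unfold_locales
    show "indep_vars (\<lambda>_. borel) W UNIV"
      unfolding W_def[abs_def] using V by (rule indep_vars_compose2) measurable
    show "distributed M lborel (W n) (beta_density (1 - \<alpha>) (\<theta> + real (n + 1) * \<alpha>))" for n
    proof -
      have "distr M lborel (W n) = distr M lborel (V n)"
        using V01 by (intro distr_cong_AE) auto
      then show ?thesis using VD[of n] by (simp add: distributed_def)
    qed
    show "W n \<omega> \<in> {0..1}" for n \<omega> by (simp add: W_def r_def)
    have "indep_var (\<Pi>\<^sub>M n\<in>UNIV. borel) ((\<lambda>v n. r (v n)) \<circ> (\<lambda>\<omega> n. V n \<omega>))
        (\<Pi>\<^sub>M n\<in>UNIV. borel) ((\<lambda>x. x) \<circ> (\<lambda>\<omega> n. \<xi> n \<omega>))"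
      by (rule indep_var_compose[OF ind]) (auto intro!: measurable_PiM_single' simp: space_PiM)
    then show "indep_var (\<Pi>\<^sub>M n\<in>UNIV. borel) (\<lambda>\<omega> n. W n \<omega>) (\<Pi>\<^sub>M n\<in>UNIV. borel) (\<lambda>\<omega> n. \<xi> n \<omega>)"
      by (simp add: comp_def W_def)
  qed (fact assms \<alpha>1 \<xi> \<xi>D)+
  moreover have "AE \<omega> in M. p \<omega> = weighted_diracs (stick_weight (\<lambda>n. W n \<omega>)) (\<lambda>n. \<xi> n \<omega>)"
  proof -
    have "AE \<omega> in M. \<forall>n. W n \<omega> = V n \<omega>" using V01 by (simp add: AE_all_countable)
    then show ?thesis using AE_space by eventually_elim (simp add: p)
  qed
  moreover have "(\<lambda>\<omega>. LINT x|p \<omega>. f x) \<in> borel_measurable M"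
    if "f \<in> borel_measurable borel" for f :: "real \<Rightarrow> real"
  proof -
    have "(\<lambda>\<omega>. stick_weight (\<lambda>n. V n \<omega>) n) \<in> borel_measurable M" for n
      unfolding stick_weight_def by measurable
    then have "(\<lambda>\<omega>. LINT x|weighted_diracs (stick_weight (\<lambda>n. V n \<omega>)) (\<lambda>n. \<xi> n \<omega>). f x) \<in> borel_measurable M"
      using that by (intro measurable_integral_weighted_diracs) auto
    then show ?thesis by (subst measurable_cong) (auto simp: p)
  qed
  ultimately show ?thesis using that by blast
qed

text \<open>Boundedness and non-negativity are premises of separate implications, so the transform
  for s, t > 0 also covers unbounded \<phi> and \<psi>.\<close>

theorem proposition3p3:
  fixes M :: "'a measure" and p :: "'a \<Rightarrow> real measure" and G :: "real measure"
    and \<alpha> \<theta> :: real and \<phi> \<psi> :: "real \<Rightarrow> real" and L1 L2 :: "'a \<Rightarrow> real"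
  assumes "0 < \<alpha>" and "\<alpha> < 1" and "0 < \<theta>"
    and "prob_space G" and "sets G = sets borel"
    and "pitman_yor_process M \<alpha> \<theta> G p"
    and "\<phi> \<in> borel_measurable borel" and "\<psi> \<in> borel_measurable borel"
    and "L1 = (\<lambda>\<omega>. LINT x|p \<omega>. \<phi> x)" and "L2 = (\<lambda>\<omega>. LINT x|p \<omega>. \<psi> x)"
  shows "((\<forall>x. \<bar>\<phi> x\<bar> \<le> 1) \<and> (\<forall>x. \<bar>\<psi> x\<bar> \<le> 1) \<longrightarrow>
            (\<forall>n m :: nat.
               (LINT \<omega>|M. L1 \<omega> ^ n * L2 \<omega> ^ m)
                 = fact n / fact (n + m) * (1 / pochhammer \<theta> (n + m)) *
                   mixed_partial (n + m) m
                     (\<lambda>z w. (LINT x|G. (1 - z * (\<phi> x + w * \<psi> x)) powr \<alpha>) powr (- \<theta> / \<alpha>)) 0 0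
             \<and> (LINT \<omega>|M. L1 \<omega> ^ n * L2 \<omega> ^ m)
                 = 1 / pochhammer \<theta> (n + m) *
                   mixed_partial n m
                     (\<lambda>u v. (LINT x|G. (1 - u * \<phi> x - v * \<psi> x) powr \<alpha>) powr (- \<theta> / \<alpha>)) 0 0)
          \<and> (\<forall>s t :: real. \<bar>s\<bar> < 1 / 2 \<and> \<bar>t\<bar> < 1 / 2 \<longrightarrow>
               (LINT \<omega>|M. (1 / (1 + s * L1 \<omega> + t * L2 \<omega>)) powr \<theta>)
                 = (LINT x|G. (1 + s * \<phi> x + t * \<psi> x) powr \<alpha>) powr (- \<theta> / \<alpha>)))
       \<and> ((\<forall>x. 0 \<le> \<phi> x) \<and> (\<forall>x. 0 \<le> \<psi> x) \<and> integrable G (\<lambda>x. \<phi> x powr \<alpha> + \<psi> x powr \<alpha>) \<longrightarrow>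
            (\<forall>s t :: real. 0 < s \<and> 0 < t \<longrightarrow>
               (LINT \<omega>|M. (1 / (1 + s * L1 \<omega> + t * L2 \<omega>)) powr \<theta>)
                 = (LINT x|G. (1 + s * \<phi> x + t * \<psi> x) powr \<alpha>) powr (- \<theta> / \<alpha>)))"
proof -
  obtain V \<xi> where "stick_breaking M \<alpha> \<theta> G V \<xi>"
    and p: "AE \<omega> in M. p \<omega> = weighted_diracs (stick_weight (\<lambda>n. V n \<omega>)) (\<lambda>n. \<xi> n \<omega>)"
    and meas: "\<And>f :: real \<Rightarrow> real. f \<in> borel_measurable borel \<Longrightarrow> (\<lambda>\<omega>. LINT x|p \<omega>. f x) \<in> borel_measurable M"
    using pitman_yor_process_stick_breaking assms(1,3,6) by blast
  then interpret stick_breaking M \<alpha> \<theta> G V \<xi> by blast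
  note [measurable] = \<open>\<phi> \<in> borel_measurable borel\<close> \<open>\<psi> \<in> borel_measurable borel\<close>
  have L_meas [measurable]: "L1 \<in> borel_measurable M" "L2 \<in> borel_measurable M"
    unfolding assms(9,10) by (intro meas; fact)+
  \<comment> \<open>The process agrees with its clamped representation only almost surely, so each
    expectation has to be carried across a null set.\<close>
  have transfer: "(LINT \<omega>|M. F (L1 \<omega>) (L2 \<omega>)) = (LINT \<omega>|M. F (Y1 \<omega>) (Y2 \<omega>))"
    if "AE \<omega> in M. L1 \<omega> = Y1 \<omega> \<and> L2 \<omega> = Y2 \<omega>" "(\<lambda>\<omega>. F (L1 \<omega>) (L2 \<omega>)) \<in> borel_measurable M"
      "(\<lambda>\<omega>. F (Y1 \<omega>) (Y2 \<omega>)) \<in> borel_measurable M" for F :: "real \<Rightarrow> real \<Rightarrow> real" and Y1 Y2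
    using that by (intro integral_cong_AE) auto
  have recip: "(1 / x) powr \<theta> = x powr (- \<theta>)" for x :: real
    by (simp add: powr_divide powr_minus_divide)
  let ?P = "\<lambda>\<omega>. weighted_diracs (stick_weight (\<lambda>n. V n \<omega>)) (\<lambda>n. \<xi> n \<omega>)"
  have L_P: "AE \<omega> in M. L1 \<omega> = (LINT x|?P \<omega>. \<phi> x) \<and> L2 \<omega> = (LINT x|?P \<omega>. \<psi> x)"
    using p by eventually_elim (simp add: assms(9,10))
  show ?thesis
  proof (intro conjI impI allI; (elim conjE)?)
    assume b: "\<forall>x. \<bar>\<phi> x\<bar> \<le> 1" "\<forall>x. \<bar>\<psi> x\<bar> \<le> 1"
    have L_X: "AE \<omega> in M. L1 \<omega> = X \<phi> 0 \<omega> \<and> L2 \<omega> = X \<psi> 0 \<omega>"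
      using L_P b integral_weighted_diracs_eq_X[of \<phi> 1] integral_weighted_diracs_eq_X[of \<psi> 1] by simp
    {
      fix n m
      have moments: "(LINT \<omega>|M. L1 \<omega> ^ n * L2 \<omega> ^ m) = (LINT \<omega>|M. X \<phi> 0 \<omega> ^ n * X \<psi> 0 \<omega> ^ m)"
        by (rule transfer[OF L_X]) measurable
      show "(LINT \<omega>|M. L1 \<omega> ^ n * L2 \<omega> ^ m) = fact n / fact (n + m) * (1 / pochhammer \<theta> (n + m)) *
         mixed_partial (n + m) m (\<lambda>z w. (LINT x|G. (1 - z * (\<phi> x + w * \<psi> x)) powr \<alpha>) powr (- \<theta> / \<alpha>)) 0 0"
        unfolding moments using b by (intro joint_moment_product) auto
      show "(LINT \<omega>|M. L1 \<omega> ^ n * L2 \<omega> ^ m) = 1 / pochhammer \<theta> (n + m) *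
         mixed_partial n m (\<lambda>u v. (LINT x|G. (1 - u * \<phi> x - v * \<psi> x) powr \<alpha>) powr (- \<theta> / \<alpha>)) 0 0"
        unfolding moments using b by (intro joint_moment_linear) auto
    next
      fix s t :: real assume st: "\<bar>s\<bar> < 1 / 2" "\<bar>t\<bar> < 1 / 2"
      have "(LINT \<omega>|M. (1 / (1 + s * L1 \<omega> + t * L2 \<omega>)) powr \<theta>) =
          (LINT \<omega>|M. (1 / (1 + s * X \<phi> 0 \<omega> + t * X \<psi> 0 \<omega>)) powr \<theta>)"
        by (rule transfer[OF L_X]) measurable
      then show "(LINT \<omega>|M. (1 / (1 + s * L1 \<omega> + t * L2 \<omega>)) powr \<theta>) =
          (LINT x|G. (1 + s * \<phi> x + t * \<psi> x) powr \<alpha>) powr (- \<theta> / \<alpha>)"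
        unfolding recip using joint_transform[of \<phi> \<psi> "- s" "- t"] b st by simp
    }
  next
    fix s t :: real
    assume "\<forall>x. 0 \<le> \<phi> x" "\<forall>x. 0 \<le> \<psi> x" "integrable G (\<lambda>x. \<phi> x powr \<alpha> + \<psi> x powr \<alpha>)" "0 < s" "0 < t"
    moreover have "(\<lambda>\<omega>. stick_weight (\<lambda>n. V n \<omega>) n) \<in> borel_measurable M" for n
      unfolding stick_weight_def by measurable
    then have [measurable]: "(\<lambda>\<omega>. LINT x|?P \<omega>. f x) \<in> borel_measurable M"
      if "f \<in> borel_measurable borel" for f :: "real \<Rightarrow> real"
      using that by (intro measurable_integral_weighted_diracs) auto
    have "(LINT \<omega>|M. (1 / (1 + s * L1 \<omega> + t * L2 \<omega>)) powr \<theta>) =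
        (LINT \<omega>|M. (1 / (1 + s * (LINT x|?P \<omega>. \<phi> x) + t * (LINT x|?P \<omega>. \<psi> x))) powr \<theta>)"
      by (rule transfer[OF L_P]) measurable
    ultimately show "(LINT \<omega>|M. (1 / (1 + s * L1 \<omega> + t * L2 \<omega>)) powr \<theta>) =
          (LINT x|G. (1 + s * \<phi> x + t * \<psi> x) powr \<alpha>) powr (- \<theta> / \<alpha>)"
      unfolding recip using stieltjes_unbounded[of \<phi> \<psi> s t] by simp
  qed
qed

end
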